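(* Suppose $\lim_{n\to\infty}h_{n-1}/h_n=1$. Let $k\ge1$ and let $f_m\colon\mathbb X_m\to[0,\infty)$, $m\in\{1,\ldots,k\}$, be continuous functions. Denote by $\mathcal C_m(\sigma_n)$ the set of all $m$-cycles of $\sigma_n$, where each $c\in\mathcal C_m(\sigma_n)$ is understood as an integer $m$-tuple whose minimum element comes first. Then $$\sum_{m=1}^k\ \sum_{c\in\mathcal C_m(\sigma_n)}f_m\!\left(\frac cn\right)\xrightarrow{d}S,\qquad n\to\infty,$$ where the distribution of the limiting random variable $S$ is defined by its Laplace transform $$\mathbb E\exp\{-tS\}=\exp\Bigl\{-\sum_{m=1}^k\theta_m\int_{\mathbb X_m}\bigl(1-e^{-tf_m(\boldsymbol x)}\bigr)\,d\boldsymbol x\Bigr\},\qquad t\ge0.$$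
   Context: Weighted permutations: let $\theta_k\ge 0$, $k\ge1$. For $\pi$ in the symmetric group $\mathcal S_n$ (permutations of $\{1,\ldots,n\}$) let $C_k(\pi)$ be the number of $k$-cycles of $\pi$. The random permutation $\sigma_n$ has distribution $\mathbb P\{\sigma_n=\pi\}=\frac{1}{h_n n!}\prod_{k=1}^\infty\theta_k^{C_k(\pi)}$, $\pi\in\mathcal S_n$, where $h_n=\frac1{n!}\sum_{\pi\in\mathcal S_n}\prod_{k=1}^\infty\theta_k^{C_k(\pi)}$ is the normalization (the condition $h_{n-1}/h_n\to1$ presupposes $h_n>0$ for all large $n$, which are the $n$ considered). For $m\ge1$, $\mathbb X_m=\{(x_1,\ldots,x_m)\in[0,1]^m:\min\{x_1,\ldots,x_m\}=x_1\}$ with the Euclidean metric; $d\boldsymbol x$ denotes $m$-dimensional Lebesgue measure. A tuple $c=(i_1,\ldots,i_m)$ represents the cycle with $\sigma_n(i_1)=i_2,\ldots,\sigma_n(i_m)=i_1$, and $c/n=(i_1/n,\ldots,i_m/n)$. $\xrightarrow{d}$ is convergence in distribution. *)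

theory Defs
  imports "HOL-Probability.Probability" "HOL-Combinatorics.Permutations"
begin

text \<open>
  An \<open>m\<close>-tuple of integers is a list of length \<open>m\<close>, and a point of the \<open>m\<close>-dimensional space is
  an extensional function on \<open>{..<m}\<close>; coordinates are thus numbered from \<open>0\<close>.
\<close>

definition cycles_of_length :: "nat \<Rightarrow> nat \<Rightarrow> (nat \<Rightarrow> nat) \<Rightarrow> nat list set" where
  "cycles_of_length n m p =
     {c. length c = m \<and> distinct c \<and> set c \<subseteq> {1..n} \<and> c ! 0 = Min (set c) \<and>
         (\<forall>j<m. p (c ! j) = c ! (Suc j mod m))}"

definition cycle_count :: "nat \<Rightarrow> nat \<Rightarrow> (nat \<Rightarrow> nat) \<Rightarrow> nat" where
  "cycle_count n m p = card (cycles_of_length n m p)"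

text \<open>The factor with index \<open>j\<close> belongs to the cycle length \<open>Suc j\<close>.\<close>

definition cycle_weight :: "(nat \<Rightarrow> real) \<Rightarrow> nat \<Rightarrow> (nat \<Rightarrow> nat) \<Rightarrow> real" where
  "cycle_weight \<theta> n p = (\<Prod>j. \<theta> (Suc j) ^ cycle_count n (Suc j) p)"

lemma cycle_count_eq_0: "n < m \<Longrightarrow> cycle_count n m p = 0"
proof -
  assume "n < m"
  have "length c \<le> n" if "distinct c" "set c \<subseteq> {1..n}" for c :: "nat list"
    using card_mono[OF _ that(2)] distinct_card[OF that(1)] by simp
  with \<open>n < m\<close> have "cycles_of_length n m p = {}"
    unfolding cycles_of_length_def by fastforce
  then show ?thesis
    by (simp add: cycle_count_def)
qed

lemma cycle_weight_eq_prod: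
  "cycle_weight \<theta> n p = (\<Prod>m=1..n. \<theta> m ^ cycle_count n m p)"
proof -
  have "cycle_weight \<theta> n p = (\<Prod>j<n. \<theta> (Suc j) ^ cycle_count n (Suc j) p)"
    unfolding cycle_weight_def by (rule prodinf_finite) (auto simp: cycle_count_eq_0)
  also have "\<dots> = (\<Prod>m=1..n. \<theta> m ^ cycle_count n m p)"
    by (rule prod.reindex_bij_witness[of _ "\<lambda>m. m - 1" Suc]) auto
  finally show ?thesis .
qed

definition perm_norm :: "(nat \<Rightarrow> real) \<Rightarrow> nat \<Rightarrow> real" where
  "perm_norm \<theta> n = (\<Sum>p | p permutes {1..n}. cycle_weight \<theta> n p) / fact n"

text \<open>
  For nonnegative weights this is a probability measure iff
  \<open>perm_norm \<theta> n > 0\<close>; otherwise it is the zero measure, by \<open>x / 0 = 0\<close>.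
\<close>

definition weighted_perm :: "(nat \<Rightarrow> real) \<Rightarrow> nat \<Rightarrow> (nat \<Rightarrow> nat) measure" where
  "weighted_perm \<theta> n =
     point_measure {p. p permutes {1..n}}
       (\<lambda>p. ennreal (cycle_weight \<theta> n p / (perm_norm \<theta> n * fact n)))"

text \<open>
  On extensional functions on \<open>{..<m}\<close>, the topology of the function type is the Euclidean one,
  so continuity on the following set can be expressed by \<^const>\<open>continuous_on\<close>.
\<close>

definition min_first_cube :: "nat \<Rightarrow> (nat \<Rightarrow> real) set" where
  "min_first_cube m = {x \<in> {..<m} \<rightarrow>\<^sub>E {0..1}. Min (x ` {..<m}) = x 0}"

definition scaled_tuple :: "nat \<Rightarrow> nat list \<Rightarrow> nat \<Rightarrow> real" where
  "scaled_tuple n c = (\<lambda>j\<in>{..<length c}. real (c ! j) / real n)"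

definition cycle_sum ::
  "(nat \<Rightarrow> (nat \<Rightarrow> real) \<Rightarrow> real) \<Rightarrow> nat \<Rightarrow> nat \<Rightarrow> (nat \<Rightarrow> nat) \<Rightarrow> real" where
  "cycle_sum f k n p = (\<Sum>m=1..k. \<Sum>c\<in>cycles_of_length n m p. f m (scaled_tuple n c))"

definition has_laplace_transform :: "real measure \<Rightarrow> (real \<Rightarrow> real) \<Rightarrow> bool" where
  "has_laplace_transform \<mu> \<phi> \<longleftrightarrow>
     real_distribution \<mu> \<and> (AE x in \<mu>. 0 \<le> x) \<and>
     (\<forall>t\<ge>0. (LINT x|\<mu>. exp (- t * x)) = \<phi> t)"

definition limit_laplace ::
  "(nat \<Rightarrow> real) \<Rightarrow> (nat \<Rightarrow> (nat \<Rightarrow> real) \<Rightarrow> real) \<Rightarrow> nat \<Rightarrow> real \<Rightarrow> real" where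
  "limit_laplace \<theta> f k t =
     exp (- (\<Sum>m=1..k. \<theta> m *
       (LINT x:min_first_cube m|(\<Pi>\<^sub>M j\<in>{..<m}. lborel). 1 - exp (- t * f m x))))"

end

theory Submission
  imports Defs
begin

text \<open>
  With \<open>g c = 1 - exp (- t * f (c / n))\<close>, the Laplace transform of the cycle sum is the expectation of
  the product of \<open>1 - g c\<close> over the short cycles. Bonferroni's inequalities enclose this product
  between partial sums of elementary symmetric polynomials in \<open>g\<close>. Their expectations are computable,
  because deleting given disjoint cycles of total length \<open>M\<close> from a weighted permutation leaves a
  weighted permutation of \<open>n - M\<close> points; this costs the factor \<open>h (n - M) * (n - M)! / (h n * n!)\<close>,
  which is asymptotic to \<open>n ^ (- M)\<close> by the assumption on \<open>h\<close>. What remains are Riemann sums, so the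
  \<open>r\<close>-th expectation converges to \<open>\<Lambda> ^ r / r!\<close> and the Laplace transform to \<open>exp (- \<Lambda>)\<close>.
  Tightness then provides the limiting distribution; it is unique because, after the substitution
  \<open>y = exp (- x)\<close>, the Laplace transform contains all moments of a distribution on the unit interval.
\<close>

section \<open>Laplace transforms and weak convergence\<close>

text \<open>The limit is the law of a sum of integrals of the \<open>f m\<close> against independent
  Poisson processes with intensities \<open>\<theta> m\<close> times Lebesgue measure. No such
  process is built: the law arises as a subsequential limit, so the transform has to be controlled
  near 0 to keep mass from escaping. The obstacle is that the cycles of a permutation are disjoint,
  so the expected symmetric polynomials are sums over disjoint families and do not factor into
  powers. They are handled recursively: a family of \<open>r\<close> tuples of length at most
  \<open>k\<close> forbids at most \<open>k * r\<close> points, and the tuples of length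
  \<open>m\<close> through a forbidden point are only a fraction O(1/n) of all n^m. One more tuple
  thus multiplies the sum by nearly \<Lambda>, and forgetting which tuple came last divides by
  \<open>r + 1\<close>. For fixed \<open>r\<close> the deleted size \<open>M\<close> takes finitely
  many values, so the asymptotics for each single \<open>M\<close> suffice. Deletion leaves an
  arbitrary set of points; an increasing relabelling turns it into an initial segment and keeps the
  minimum of each tuple in front.\<close>

lemma bounded_moments_determine:
  assumes "real_distribution M" "real_distribution N"
    and M: "AE x in M. \<bar>x\<bar> \<le> 1" and N: "AE x in N. \<bar>x\<bar> \<le> 1"
    and eq: "\<And>j::nat. (LINT x|M. x ^ j) = (LINT x|N. x ^ j)"
  shows "M = N"
proof (rule Levy_uniqueness[OF assms(1,2)], rule ext)
  fix t :: real
  \<comment> \<open>All absolute moments are at most 1, so the Taylor remainder of the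
    characteristic function vanishes and \<open>char P t\<close> is a series in the moments
    alone.\<close>
  have lim: "(\<lambda>j. \<Sum>i\<le>j. ((\<i> * t) ^ i / fact i) * (LINT x|P. x ^ i)) \<longlonglongrightarrow> char P t"
    if "real_distribution P" and P: "AE x in P. \<bar>x\<bar> \<le> 1" for P
  proof -
    interpret real_distribution P by fact
    have int: "integrable P (\<lambda>x. x ^ j)" for j
      using P by (intro integrable_const_bound[of _ 1])
        (auto simp: power_abs power_le_one elim!: eventually_mono)
    have le: "expectation (\<lambda>x. \<bar>x\<bar> ^ j) \<le> 1" for j
    proof -
      have "expectation (\<lambda>x. \<bar>x\<bar> ^ j) \<le> expectation (\<lambda>x. 1)"
        using P integrable_abs[OF int]
        by (intro integral_mono_AE) (auto simp: power_abs power_le_one elim!: eventually_mono)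
      then show ?thesis
        using prob_space by simp
    qed
    have bound: "cmod (char P t - (\<Sum>i\<le>j. ((\<i> * t) ^ i / fact i) * (LINT x|P. x ^ i)))
        \<le> 2 * (\<bar>t\<bar> ^ j / fact j)" for j
    proof -
      have "(2 * \<bar>t\<bar> ^ j / fact j) * expectation (\<lambda>x. \<bar>x\<bar> ^ j) \<le> (2 * \<bar>t\<bar> ^ j / fact j) * 1"
        by (intro mult_left_mono le) auto
      with order_trans[OF char_approx1[of j t]] int show ?thesis
        by simp
    qed
    have "(\<lambda>j. 2 * (\<bar>t\<bar> ^ j / fact j)) \<longlonglongrightarrow> 0"
      using summable_LIMSEQ_zero[OF summable_exp[of "\<bar>t\<bar>"]]
      by (intro tendsto_mult_right_zero) (simp add: field_simps)
    then have "(\<lambda>j. char P t - (\<Sum>i\<le>j. ((\<i> * t) ^ i / fact i) * (LINT x|P. x ^ i))) \<longlonglongrightarrow> 0"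
      by (rule Lim_null_comparison[OF always_eventually[OF allI[OF bound]]])
    from tendsto_diff[OF tendsto_const[of "char P t"] this] show ?thesis
      by simp
  qed
  show "char M t = char N t"
    using lim[OF assms(1) M] lim[OF assms(2) N] by (intro LIMSEQ_unique) (auto simp: eq)
qed

text \<open>Only the values at natural numbers enter, as moments of the image under
  \<open>exp (- x)\<close>. The image determines the law because \<open>- ln y\<close> inverts this
  map on the whole line.\<close>

lemma has_laplace_transform_unique:
  assumes "has_laplace_transform \<mu> \<phi>" "has_laplace_transform \<nu> \<phi>"
  shows "\<mu> = \<nu>"
proof -
  let ?e = "\<lambda>x::real. exp (- x)" and ?l = "\<lambda>y::real. - ln y"
  have P: "real_distribution (distr P borel ?e)" "AE y in distr P borel ?e. \<bar>y\<bar> \<le> 1"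
      "(LINT y|distr P borel ?e. y ^ j) = \<phi> (real j)" "distr (distr P borel ?e) borel ?l = P"
    if *: "has_laplace_transform P \<phi>" for P j
  proof -
    interpret real_distribution P
      using * by (simp add: has_laplace_transform_def)
    show "real_distribution (distr P borel ?e)"
      by simp
    show "AE y in distr P borel ?e. \<bar>y\<bar> \<le> 1"
      using * by (subst AE_distr_iff) (auto simp: has_laplace_transform_def)
    show "(LINT y|distr P borel ?e. y ^ j) = \<phi> (real j)"
      using * by (simp add: integral_distr has_laplace_transform_def exp_of_nat_mult[symmetric])
    show "distr (distr P borel ?e) borel ?l = P"
      by (subst distr_distr) (auto simp: comp_def intro!: distr_id2)
  qed
  have "distr \<mu> borel ?e = distr \<nu> borel ?e"
    using P(1-3)[OF assms(1)] P(1-3)[OF assms(2)]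
    by (intro bounded_moments_determine) auto
  then show ?thesis
    using P(4)[OF assms(1)] P(4)[OF assms(2)] by metis
qed

lemma laplace_transform_weak_limit:
  assumes \<mu>: "\<And>n. real_distribution (\<mu> n)" "\<And>n. AE x in \<mu> n. 0 \<le> x"
    and "real_distribution \<nu>" and conv: "weak_conv_m \<mu> \<nu>"
    and lim: "\<And>t. 0 \<le> t \<Longrightarrow> (\<lambda>n. LINT x|\<mu> n. exp (- t * x)) \<longlonglongrightarrow> \<phi> t"
  shows "has_laplace_transform \<nu> \<phi>"
proof -
  interpret \<nu>: real_distribution \<nu> by fact
  have int: "(\<lambda>n. LINT x|\<mu> n. h x) \<longlonglongrightarrow> (LINT x|\<nu>. h x)"
    if "\<And>x. isCont h x" "\<And>x. \<bar>h x\<bar> \<le> 1" for h :: "real \<Rightarrow> real"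
    using weak_conv_imp_integral_bdd_continuous_conv[OF \<mu>(1) assms(3) conv that(1), of 1] that(2)
    by simp
  \<comment> \<open>A bounded continuous function that is positive exactly on the negative
    half-line; its vanishing integral survives the weak limit.\<close>
  let ?h = "\<lambda>x::real. min 1 (max 0 (- x))"
  have "(LINT x|\<mu> n. ?h x) = 0" for n
    using \<mu>(2)[of n] by (intro integral_eq_zero_AE) (auto elim!: eventually_mono)
  then have "(LINT x|\<nu>. ?h x) = 0"
    using int[of ?h] by (simp add: LIMSEQ_const_iff continuous_intros)
  moreover have "integrable \<nu> ?h"
    by (intro \<nu>.integrable_const_bound[of _ 1]) auto
  ultimately have "AE x in \<nu>. ?h x = 0"
    by (subst (asm) integral_nonneg_eq_0_iff_AE) auto
  then have nonneg: "AE x in \<nu>. 0 \<le> x"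
    by (rule eventually_mono) (auto simp: min_def max_def split: if_splits)
  have "(LINT x|\<nu>. exp (- t * x)) = \<phi> t" if "0 \<le> t" for t
  proof -
    \<comment> \<open>For negative \<open>x\<close> the function \<open>exp (- t * x)\<close> may be
      unbounded, hence no admissible test function; \<open>?g\<close> is bounded and agrees with it
      almost everywhere for all laws concerned.\<close>
    let ?g = "\<lambda>x::real. exp (- t * max 0 x)"
    have eq: "(LINT x|P. exp (- t * x)) = (LINT x|P. ?g x)"
      if "real_distribution P" "AE x in P. 0 \<le> x" for P
    proof -
      interpret real_distribution P by fact
      show ?thesis
        by (intro integral_cong_AE eventually_mono[OF that(2)]) auto
    qed
    have "(\<lambda>n. LINT x|\<mu> n. ?g x) \<longlonglongrightarrow> (LINT x|\<nu>. ?g x)"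
      using \<open>0 \<le> t\<close> by (intro int) (auto intro!: continuous_intros)
    with lim[OF that] show ?thesis
      using eq[OF \<mu>] eq[OF assms(3) nonneg] by (simp add: LIMSEQ_unique)
  qed
  with nonneg assms(3) show ?thesis
    by (simp add: has_laplace_transform_def)
qed

text \<open>Chebyshev's inequality for \<open>1 - exp (- x / b)\<close>, which is at least \<open>1 / 2\<close> for \<open>x > b\<close>.\<close>

lemma (in real_distribution) laplace_tail_bound:
  assumes "AE x in M. 0 \<le> x" "0 < b"
  shows "1 - measure M {..b} \<le> 2 * (1 - (LINT x|M. exp (- (1 / b) * x)))"
proof -
  have int: "integrable M (\<lambda>x. exp (- (1 / b) * x))"
    using assms by (intro integrable_const_bound[of _ 1]) (auto elim!: eventually_mono)
  have "1 - measure M {..b} = measure M (space M - {..b})"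
    by (subst prob_compl) auto
  also have "\<dots> = (LINT x|M. indicator {b<..} x)"
    by (simp add: Compl_eq_Diff_UNIV[symmetric] Compl_atMost)
  also have "\<dots> \<le> (LINT x|M. 2 * (1 - exp (- (1 / b) * x)))"
  proof (rule integral_mono_AE)
    have "indicator {b<..} x \<le> 2 * (1 - exp (- (1 / b) * x))" if "0 \<le> x" for x :: real
    proof (cases "b < x")
      case True
      then have "exp (- (1 / b) * x) \<le> exp (- 1)"
        using assms(2) by (simp add: field_simps)
      also have "exp (- 1 :: real) \<le> 1 / 2"
        using exp_ge_add_one_self[of 1] by (simp add: exp_minus field_simps)
      finally show ?thesis
        using True by simp
    qed (use that assms(2) in auto)
    then show "AE x in M. indicator {b<..} x \<le> 2 * (1 - exp (- (1 / b) * x))"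
      using assms(1) by (auto elim!: eventually_mono)
  qed (use int in \<open>auto intro!: integrable_real_indicator simp: less_top[symmetric]\<close>)
  also have "\<dots> = 2 * (1 - (LINT x|M. exp (- (1 / b) * x)))"
    using int prob_space by (simp add: Bochner_Integration.integral_diff)
  finally show ?thesis .
qed

text \<open>A transform close to 1 at \<open>1 / b\<close> bounds the mass beyond \<open>b\<close>.
  One such \<open>b\<close> serves all large \<open>n\<close>; each of the finitely many remaining
  laws is tight by itself.\<close>

lemma tight_if_laplace_converges:
  assumes \<mu>: "\<And>n. real_distribution (\<mu> n)" "\<And>n. AE x in \<mu> n. 0 \<le> x"
    and lim: "\<And>t. 0 \<le> t \<Longrightarrow> (\<lambda>n. LINT x|\<mu> n. exp (- t * x)) \<longlonglongrightarrow> \<phi> t"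
    and \<phi>: "(\<lambda>j. \<phi> (1 / real (Suc j))) \<longlonglongrightarrow> 1"
  shows "tight \<mu>"
  unfolding tight_def
proof (intro conjI allI impI \<mu>(1))
  interpret \<mu>: real_distribution "\<mu> n" for n by fact
  fix \<epsilon> :: real
  assume "0 < \<epsilon>"
  \<comment> \<open>The half of \<epsilon> makes up for the factor 2 in the tail bound.\<close>
  have "eventually (\<lambda>j. 1 - \<epsilon> / 2 < \<phi> (1 / real (Suc j))) sequentially"
    using \<phi> \<open>0 < \<epsilon>\<close> by (intro order_tendstoD(1)) auto
  then obtain j where j: "1 - \<epsilon> / 2 < \<phi> (1 / real (Suc j))"
    by (auto simp: eventually_sequentially)
  let ?b = "real (Suc j)"
  have "eventually (\<lambda>n. 1 - \<epsilon> / 2 < (LINT x|\<mu> n. exp (- (1 / ?b) * x))) sequentially"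
    using lim[of "1 / ?b"] j by (intro order_tendstoD(1)) auto
  then obtain N where N: "\<And>n. N \<le> n \<Longrightarrow> 1 - \<epsilon> / 2 < (LINT x|\<mu> n. exp (- (1 / ?b) * x))"
    by (auto simp: eventually_sequentially)
  have tail: "1 - \<epsilon> < measure (\<mu> n) {..?b}" if "N \<le> n" for n
    using \<mu>.laplace_tail_bound[OF \<mu>(2)[of n], of ?b] N[OF that] by simp
  have "eventually (\<lambda>b. \<forall>n\<in>{..<N}. 1 - \<epsilon> < cdf (\<mu> n) b) at_top"
    using \<open>0 < \<epsilon>\<close> \<mu>.cdf_lim_at_top_prob
    by (intro eventually_ball_finite ballI order_tendstoD(1)[of _ 1]) auto
  then have "eventually (\<lambda>b. (\<forall>n\<in>{..<N}. 1 - \<epsilon> < cdf (\<mu> n) b) \<and> ?b \<le> b) at_top"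
    using eventually_ge_at_top by (rule eventually_conj)
  then obtain b where b: "\<And>n. n < N \<Longrightarrow> 1 - \<epsilon> < cdf (\<mu> n) b" "?b \<le> b"
    by (auto simp: eventually_at_top_linorder)
  \<comment> \<open>The intervals in \<open>tight\<close> are open on the left, so the end point
    lies below 0 to keep a possible atom at 0.\<close>
  have "1 - \<epsilon> < measure (\<mu> n) {- 1<..b}" for n
  proof -
    have "1 - \<epsilon> < measure (\<mu> n) {..b}"
    proof (cases "n < N")
      case False
      then have "1 - \<epsilon> < measure (\<mu> n) {..?b}"
        using tail by simp
      also have "\<dots> \<le> measure (\<mu> n) {..b}"
        using b(2) by (intro \<mu>.finite_measure_mono) auto
      finally show ?thesis .
    qed (use b(1) in \<open>simp add: cdf_def\<close>)
    also have "measure (\<mu> n) {..b} = measure (\<mu> n) {- 1<..b}"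
      using \<mu>(2)[of n] by (intro \<mu>.finite_measure_eq_AE) (auto elim!: eventually_mono)
    finally show ?thesis .
  qed
  moreover have "- 1 < b"
    using b(2) by simp
  ultimately show "\<exists>a b. a < b \<and> (\<forall>n. 1 - \<epsilon> < measure (\<mu> n) {a<..b})"
    by blast
qed

text \<open>Tightness yields subsequential limits, and each of them must have the transform \<phi>.
  So a law with this transform exists; being unique, it is the limit of every convergent subsequence
  and hence of the whole sequence.\<close>

theorem laplace_continuity:
  assumes \<mu>: "\<And>n. real_distribution (\<mu> n)" "\<And>n. AE x in \<mu> n. 0 \<le> x"
    and lim: "\<And>t. 0 \<le> t \<Longrightarrow> (\<lambda>n. LINT x|\<mu> n. exp (- t * x)) \<longlonglongrightarrow> \<phi> t"
    and \<phi>: "(\<lambda>j. \<phi> (1 / real (Suc j))) \<longlonglongrightarrow> 1"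
  shows "\<exists>\<nu>. has_laplace_transform \<nu> \<phi>"
    and "has_laplace_transform \<nu> \<phi> \<Longrightarrow> weak_conv_m \<mu> \<nu>"
proof -
  have tight: "tight \<mu>"
    using assms by (rule tight_if_laplace_converges)
  have limit: "has_laplace_transform \<nu> \<phi>"
    if "strict_mono s" "real_distribution \<nu>" "weak_conv_m (\<mu> \<circ> s) \<nu>" for s \<nu>
  proof (rule laplace_transform_weak_limit[OF _ _ that(2,3)])
    show "(\<lambda>n. LINT x|(\<mu> \<circ> s) n. exp (- t * x)) \<longlonglongrightarrow> \<phi> t" if "0 \<le> t" for t
      using LIMSEQ_subseq_LIMSEQ[OF lim[OF that] \<open>strict_mono s\<close>] by (simp add: comp_def)
    show "real_distribution ((\<mu> \<circ> s) n)" "AE x in (\<mu> \<circ> s) n. 0 \<le> x" for n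
      unfolding o_apply by (rule \<mu>)+
  qed
  obtain r M where "strict_mono r" "real_distribution M" "weak_conv_m (\<mu> \<circ> id \<circ> r) M"
    using tight_imp_convergent_subsubsequence[OF tight strict_mono_id] by (auto simp: id_def)
  then show "\<exists>\<nu>. has_laplace_transform \<nu> \<phi>"
    using limit by auto
  show "weak_conv_m \<mu> \<nu>" if \<nu>: "has_laplace_transform \<nu> \<phi>"
  proof (rule tight_subseq_weak_converge[OF \<mu>(1) _ tight])
    show "real_distribution \<nu>"
      using \<nu> by (simp add: has_laplace_transform_def)
    show "weak_conv_m (\<mu> \<circ> s) \<nu>"
      if "strict_mono s" "real_distribution \<nu>'" "weak_conv_m (\<mu> \<circ> s) \<nu>'" for s \<nu>'
      using has_laplace_transform_unique[OF \<nu> limit[OF that]] that(3) by simp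
  qed
qed

section \<open>Bonferroni inequalities\<close>

definition esym :: "('a \<Rightarrow> real) \<Rightarrow> 'a set \<Rightarrow> nat \<Rightarrow> real" where
  "esym x C r = (\<Sum>R | R \<subseteq> C \<and> card R = r. \<Prod>c\<in>R. x c)"

lemma esym_0 [simp]: "finite C \<Longrightarrow> esym x C 0 = 1"
proof -
  assume "finite C"
  then have "{R. R \<subseteq> C \<and> card R = 0} = {{}}"
    by (auto dest: finite_subset)
  then show ?thesis
    by (simp add: esym_def)
qed

lemma esym_empty_Suc: "esym x {} (Suc r) = 0"
  by (simp add: esym_def)

lemma esym_insert_Suc:
  assumes "finite C" "c \<notin> C"
  shows "esym x (insert c C) (Suc r) = esym x C (Suc r) + x c * esym x C r"
proof -
  let ?D = "\<lambda>r. {R. R \<subseteq> C \<and> card R = r}"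
  have fin: "finite (?D r)" for r
    using assms(1) by simp
  have "{R. R \<subseteq> insert c C \<and> card R = Suc r} = ?D (Suc r) \<union> insert c ` ?D r"
  proof (intro equalityI subsetI)
    fix R
    assume R: "R \<in> {R. R \<subseteq> insert c C \<and> card R = Suc r}"
    show "R \<in> ?D (Suc r) \<union> insert c ` ?D r"
    proof (cases "c \<in> R")
      case True
      then have "R = insert c (R - {c})" "R - {c} \<in> ?D r"
        using R by auto
      then show ?thesis
        by blast
    qed (use R in auto)
  next
    fix R
    assume "R \<in> ?D (Suc r) \<union> insert c ` ?D r"
    moreover have "card (insert c S) = Suc (card S)" if "S \<subseteq> C" for S
      using that assms by (subst card_insert_disjoint) (auto dest: finite_subset)
    ultimately show "R \<in> {R. R \<subseteq> insert c C \<and> card R = Suc r}"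
      by auto
  qed
  moreover have "?D (Suc r) \<inter> insert c ` ?D r = {}"
    using assms(2) by auto
  moreover have "inj_on (insert c) (?D r)"
    using assms(2) by (auto intro!: inj_onI)
  moreover have "(\<Prod>d\<in>insert c R. x d) = x c * (\<Prod>d\<in>R. x d)" if "R \<in> ?D r" for R
    using that assms by (subst prod.insert) (auto dest: finite_subset)
  ultimately show ?thesis
    unfolding esym_def using fin
    by (auto simp: sum.union_disjoint sum.reindex sum_distrib_left intro!: sum.cong)
qed

text \<open>The signed form is what survives induction on \<open>C\<close>: with \<open>?D s\<close>
  for the signed error, adding \<open>c\<close> turns \<open>?D (Suc s)\<close> into
  \<open>?D (Suc s) + x c * ?D s\<close>, a sum of nonnegative terms. Two values of \<open>s\<close>
  occur, so \<open>s\<close> is generalized.\<close>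

lemma bonferroni_alternating:
  assumes "finite C" "\<And>c. c \<in> C \<Longrightarrow> 0 \<le> x c \<and> x c \<le> 1"
  shows "0 \<le> (- 1) ^ s * ((\<Sum>r\<le>s. (- 1) ^ r * esym x C r) - (\<Prod>c\<in>C. 1 - x c))"
  using assms
proof (induction C arbitrary: s rule: finite_induct)
  case empty
  then show ?case
    by (simp add: sum.atMost_shift esym_empty_Suc)
next
  case (insert c C)
  let ?D = "\<lambda>s. (- 1) ^ s * ((\<Sum>r\<le>s. (- 1) ^ r * esym x C r) - (\<Prod>c\<in>C. 1 - x c))"
  have D: "0 \<le> ?D s" for s
    using insert by auto
  have x: "0 \<le> x c" "x c \<le> 1"
    using insert.prems by auto
  show ?case
  proof (cases s)
    case 0
    have "(\<Prod>d\<in>insert c C. 1 - x d) \<le> 1"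
      using insert.prems by (intro prod_le_1) auto
    then show ?thesis
      using insert.hyps 0 by simp
  next
    case (Suc s')
    have 1: "(\<Sum>r\<le>Suc s'. (- 1) ^ r * esym x (insert c C) r) =
        (\<Sum>r\<le>Suc s'. (- 1) ^ r * esym x C r) - x c * (\<Sum>r\<le>s'. (- 1) ^ r * esym x C r)"
      using insert.hyps
      by (subst (1 2) sum.atMost_Suc_shift)
        (simp add: esym_insert_Suc sum.distrib sum_negf sum_subtractf sum_distrib_left algebra_simps)
    have 2: "(\<Prod>d\<in>insert c C. 1 - x d) = (1 - x c) * (\<Prod>d\<in>C. 1 - x d)"
      using insert.hyps by simp
    have "(- 1) ^ s * ((\<Sum>r\<le>s. (- 1) ^ r * esym x (insert c C) r) -
        (\<Prod>d\<in>insert c C. 1 - x d)) = ?D (Suc s') + x c * ?D s'"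
      unfolding Suc 1 2 by (simp add: algebra_simps del: sum.atMost_Suc)
    then show ?thesis
      using add_nonneg_nonneg[OF D[of "Suc s'"] mult_nonneg_nonneg[OF x(1) D[of s']]]
      by (simp only:)
  qed
qed

text \<open>Consecutive truncations lie on opposite sides of the product, so the error is at most
  the first omitted term.\<close>

lemma bonferroni:
  assumes "finite C" "\<And>c. c \<in> C \<Longrightarrow> 0 \<le> x c \<and> x c \<le> 1"
  shows "\<bar>(\<Prod>c\<in>C. 1 - x c) - (\<Sum>r\<le>s. (- 1) ^ r * esym x C r)\<bar> \<le> esym x C (Suc s)"
proof -
  let ?d = "(\<Sum>r\<le>s. (- 1) ^ r * esym x C r) - (\<Prod>c\<in>C. 1 - x c)"
  have "0 \<le> (- 1) ^ s * ?d"
    using assms by (rule bonferroni_alternating)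
  moreover have "0 \<le> (- 1) ^ Suc s * ((\<Sum>r\<le>Suc s. (- 1) ^ r * esym x C r) - (\<Prod>c\<in>C. 1 - x c))"
    using assms by (rule bonferroni_alternating)
  then have "(- 1) ^ s * ?d \<le> esym x C (Suc s)"
    by (simp add: algebra_simps flip: power_mult_distrib)
  moreover have "\<bar>(- 1) ^ s * ?d\<bar> = \<bar>?d\<bar>"
    by (simp add: abs_mult power_abs)
  ultimately show ?thesis
    by linarith
qed

text \<open>The order of limits matters: \<open>s\<close> is fixed first, so that the truncation
  error of the exponential series plus its next term is below \<epsilon>, and then \<open>n\<close>
  tends to infinity. Hence the bound may start at an \<open>n\<close> that depends on
  \<open>s\<close>.\<close>

lemma tendsto_exp_if_bonferroni:
  fixes L :: "nat \<Rightarrow> real"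
  assumes P: "\<And>r. (\<lambda>n. P n r) \<longlonglongrightarrow> \<Lambda> ^ r / fact r"
    and bound: "\<And>s. \<forall>\<^sub>F n in sequentially. \<bar>L n - (\<Sum>r\<le>s. (- 1) ^ r * P n r)\<bar> \<le> P n (Suc s)"
  shows "L \<longlonglongrightarrow> exp (- \<Lambda>)"
proof (rule LIMSEQ_I)
  fix \<epsilon> :: real
  assume "0 < \<epsilon>"
  let ?S = "\<lambda>s. \<Sum>r\<le>s. (- 1) ^ r * (\<Lambda> ^ r / fact r)"
  have "(\<lambda>r. (- \<Lambda>) ^ r /\<^sub>R fact r) sums exp (- \<Lambda>)"
    by (rule exp_converges)
  then have "?S \<longlonglongrightarrow> exp (- \<Lambda>)"
    by (simp add: sums_def_le divide_inverse mult_ac power_minus[of \<Lambda>])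
  then have "(\<lambda>s. \<bar>?S s - exp (- \<Lambda>)\<bar>) \<longlonglongrightarrow> 0"
    by (simp add: tendsto_rabs_zero_iff LIM_zero)
  moreover have "(\<lambda>s. \<Lambda> ^ Suc s / fact (Suc s)) \<longlonglongrightarrow> 0"
    using LIMSEQ_Suc[OF summable_LIMSEQ_zero[OF summable_exp[of \<Lambda>]]] by (simp add: field_simps)
  ultimately have "(\<lambda>s. \<bar>?S s - exp (- \<Lambda>)\<bar> + \<Lambda> ^ Suc s / fact (Suc s)) \<longlonglongrightarrow> 0 + 0"
    by (rule tendsto_add)
  then have "\<forall>\<^sub>F s in sequentially. \<bar>?S s - exp (- \<Lambda>)\<bar> + \<Lambda> ^ Suc s / fact (Suc s) < \<epsilon>"
    using \<open>0 < \<epsilon>\<close> by (intro order_tendstoD(2)) auto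
  then obtain s where s: "\<bar>?S s - exp (- \<Lambda>)\<bar> + \<Lambda> ^ Suc s / fact (Suc s) < \<epsilon>"
    by (auto simp: eventually_sequentially)
  have "(\<lambda>n. \<bar>(\<Sum>r\<le>s. (- 1) ^ r * P n r) - exp (- \<Lambda>)\<bar> + P n (Suc s)) \<longlonglongrightarrow>
      \<bar>?S s - exp (- \<Lambda>)\<bar> + \<Lambda> ^ Suc s / fact (Suc s)"
    by (intro tendsto_intros P)
  then have "\<forall>\<^sub>F n in sequentially. \<bar>(\<Sum>r\<le>s. (- 1) ^ r * P n r) - exp (- \<Lambda>)\<bar> + P n (Suc s) < \<epsilon>"
    using s by (rule order_tendstoD(2))
  with bound[of s] have "\<forall>\<^sub>F n in sequentially. norm (L n - exp (- \<Lambda>)) < \<epsilon>"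
    by eventually_elim auto
  then show "\<exists>N. \<forall>n\<ge>N. norm (L n - exp (- \<Lambda>)) < \<epsilon>"
    by (simp add: eventually_sequentially)
qed

section \<open>Deleting cycles\<close>

text \<open>The minimum in front selects one list among the rotations of a cycle. The ground set is
  arbitrary because the points left after a deletion need not form an initial segment.\<close>

definition cycle_lists :: "nat set \<Rightarrow> nat list set" where
  "cycle_lists A = {c. c \<noteq> [] \<and> distinct c \<and> set c \<subseteq> A \<and> c ! 0 = Min (set c)}"

definition cycles_on :: "nat set \<Rightarrow> (nat \<Rightarrow> nat) \<Rightarrow> nat list set" where
  "cycles_on A p = {c \<in> cycle_lists A. \<forall>j<length c. p (c ! j) = c ! (Suc j mod length c)}"

text \<open>One factor per cycle instead of one power per length, so that deleting a cycle removes
  exactly one factor.\<close>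

definition weight_on :: "(nat \<Rightarrow> real) \<Rightarrow> nat set \<Rightarrow> (nat \<Rightarrow> nat) \<Rightarrow> real" where
  "weight_on \<theta> A p = (\<Prod>c\<in>cycles_on A p. \<theta> (length c))"

definition total_weight :: "(nat \<Rightarrow> real) \<Rightarrow> nat set \<Rightarrow> real" where
  "total_weight \<theta> A = (\<Sum>p | p permutes A. weight_on \<theta> A p)"

lemma finite_cycle_lists: "finite A \<Longrightarrow> finite (cycle_lists A)"
  by (rule finite_subset[OF _ finite_subset_distinct[of A]]) (auto simp: cycle_lists_def)

lemma finite_cycles_on: "finite A \<Longrightarrow> finite (cycles_on A p)"
  unfolding cycles_on_def by (simp add: finite_cycle_lists)

lemma length_cycle_list:
  assumes "finite A" "c \<in> cycle_lists A"
  shows "1 \<le> length c" "length c \<le> card A"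
  using assms card_mono[of A "set c"] by (auto simp: cycle_lists_def distinct_card Suc_le_eq)

lemma cycles_of_length_eq: "1 \<le> m \<Longrightarrow> cycles_of_length n m p = {c \<in> cycles_on {1..n} p. length c = m}"
  by (auto simp: cycles_of_length_def cycles_on_def cycle_lists_def)

lemma cycle_weight_eq_weight_on: "cycle_weight \<theta> n p = weight_on \<theta> {1..n} p"
proof -
  have "cycle_weight \<theta> n p = (\<Prod>m=1..n. \<Prod>c\<in>{c \<in> cycles_on {1..n} p. length c = m}. \<theta> (length c))"
    by (simp add: cycle_weight_eq_prod cycle_count_def cycles_of_length_eq)
  also have "\<dots> = weight_on \<theta> {1..n} p"
    unfolding weight_on_def using length_cycle_list[of "{1..n}"]
    by (intro prod.group finite_cycles_on) (auto simp: cycles_on_def)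
  finally show ?thesis .
qed

lemma perm_norm_eq_total_weight: "perm_norm \<theta> n * fact n = total_weight \<theta> {1..n}"
  by (simp add: perm_norm_def total_weight_def cycle_weight_eq_weight_on)

lemma weight_on_nonneg:
  "\<forall>j\<ge>1. 0 \<le> \<theta> j \<Longrightarrow> 0 \<le> weight_on \<theta> A p"
  by (auto simp: weight_on_def cycles_on_def cycle_lists_def Suc_le_eq intro!: prod_nonneg)

lemma funpow_cycle:
  assumes "c \<in> cycles_on A p" "i < length c"
  shows "(p ^^ t) (c ! i) = c ! ((i + t) mod length c)"
proof (induction t)
  case (Suc t)
  have "(i + t) mod length c < length c"
    using assms(2) by (intro mod_less_divisor) auto
  then show ?case
    using assms Suc by (simp add: cycles_on_def mod_Suc_eq)
qed (use assms in simp)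

text \<open>Following \<open>p\<close> from any index runs through all indices modulo the length.
  Consequently two cycles with a common point have the same points.\<close>

lemma set_cycle:
  assumes "c \<in> cycles_on A p" "x \<in> set c"
  shows "set c = range (\<lambda>t. (p ^^ t) x)"
proof -
  obtain i where i: "i < length c" "x = c ! i"
    using assms(2) by (auto simp: in_set_conv_nth)
  \<comment> \<open>Starting at index \<open>i\<close>, this many steps lead to
    \<open>length c + j\<close>, which is \<open>j\<close> modulo the length.\<close>
  have "c ! j = (p ^^ (length c - i + j)) x" if "j < length c" for j
    using funpow_cycle[OF assms(1) i(1), of "length c - i + j"] i that by simp
  then have "set c \<subseteq> range (\<lambda>t. (p ^^ t) x)"
    by (auto simp: in_set_conv_nth)
  moreover have "(p ^^ t) x \<in> set c" for t
    using funpow_cycle[OF assms(1) i(1), of t] i by (auto intro!: nth_mem mod_less_divisor)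
  ultimately show ?thesis
    by auto
qed

text \<open>As orbits of a common point both have the same points, hence the same minimum in front;
  from there \<open>p\<close> dictates all further entries.\<close>

lemma cycles_eq_if_meet:
  assumes c: "c \<in> cycles_on A p" and d: "d \<in> cycles_on A p" and "set c \<inter> set d \<noteq> {}"
  shows "c = d"
proof (rule nth_equalityI)
  obtain x where "x \<in> set c" "x \<in> set d"
    using assms(3) by auto
  then have set: "set c = set d"
    using set_cycle[OF c] set_cycle[OF d] by metis
  then show len: "length c = length d"
    using c d by (metis (no_types, lifting) cycle_lists_def cycles_on_def distinct_card mem_Collect_eq)
  have eq: "c ! 0 = d ! 0" "0 < length c"
    using c d set by (auto simp: cycles_on_def cycle_lists_def)
  show "c ! j = d ! j" if "j < length c" for j
    using funpow_cycle[OF c eq(2), of j] funpow_cycle[OF d eq(2)[unfolded len], of j] that len eq(1)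
    by simp
qed

text \<open>Agreement is asked only outside \<open>set c\<close>, so this serves both for cutting a
  cycle out of \<open>p\<close> and for gluing one into \<open>q\<close>.\<close>

lemma cycles_on_eq_insert:
  assumes c: "c \<in> cycles_on A p"
    and eq: "\<And>x. x \<in> A - set c \<Longrightarrow> q x = p x"
  shows "cycles_on A p = insert c (cycles_on (A - set c) q)"
proof (intro equalityI subsetI)
  fix d
  assume d: "d \<in> cycles_on A p"
  show "d \<in> insert c (cycles_on (A - set c) q)"
  proof (cases "c = d")
    case False
    then have "set d \<subseteq> A - set c"
      using cycles_eq_if_meet[OF c d] d by (auto simp: cycles_on_def cycle_lists_def)
    moreover from this have "q (d ! j) = p (d ! j)" if "j < length d" for j
      using eq[of "d ! j"] that nth_mem by blast
    ultimately show ?thesis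
      using d by (auto simp: cycles_on_def cycle_lists_def)
  qed simp
next
  fix d
  assume "d \<in> insert c (cycles_on (A - set c) q)"
  moreover have "p (d ! j) = q (d ! j)" if "set d \<subseteq> A - set c" "j < length d" for d j
    using eq[of "d ! j"] that nth_mem by fastforce
  ultimately show "d \<in> cycles_on A p"
    using c by (auto simp: cycles_on_def cycle_lists_def)
qed

section \<open>Deleting and inserting given cycles\<close>

definition cycle_map :: "nat list \<Rightarrow> nat \<Rightarrow> nat" where
  "cycle_map c x = c ! (Suc (THE j. j < length c \<and> c ! j = x) mod length c)"

lemma cycle_map_nth:
  assumes "distinct c" "j < length c"
  shows "cycle_map c (c ! j) = c ! (Suc j mod length c)"
proof -
  have "(THE i. i < length c \<and> c ! i = c ! j) = j"
    using assms by (intro the_equality) (auto simp: nth_eq_iff_index_eq)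
  then show ?thesis
    by (simp add: cycle_map_def)
qed

lemma bij_betw_cycle_map:
  assumes "distinct c"
  shows "bij_betw (cycle_map c) (set c) (set c)"
proof -
  have "set c \<subseteq> cycle_map c ` set c"
  proof
    fix x
    assume "x \<in> set c"
    then obtain i where i: "i < length c" "x = c ! i"
      by (auto simp: in_set_conv_nth)
    \<comment> \<open>The cyclic predecessor of \<open>i\<close>. It yields surjectivity, which on a
      finite set implies injectivity.\<close>
    define j where "j = (if i = 0 then length c - 1 else i - 1)"
    have "j < length c" "Suc j mod length c = i"
      using i by (auto simp: j_def)
    then show "x \<in> cycle_map c ` set c"
      using cycle_map_nth[OF assms, of j] i by (intro image_eqI[of _ _ "c ! j"]) auto
  qed
  moreover have "cycle_map c x \<in> set c" if x: "x \<in> set c" for x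
  proof -
    obtain i where i: "i < length c" "x = c ! i"
      using x by (auto simp: in_set_conv_nth)
    then show ?thesis
      using cycle_map_nth[OF assms i(1)] by (auto intro!: nth_mem mod_less_divisor)
  qed
  ultimately have "cycle_map c ` set c = set c"
    by auto
  then show ?thesis
    by (simp add: bij_betw_def eq_card_imp_inj_on)
qed

text \<open>Cutting out \<open>c\<close> and gluing it in are mutually inverse maps between
  permutations of \<open>A\<close> with the cycle \<open>c\<close> and permutations of
  \<open>A - set c\<close>; the weights differ by the factor of \<open>c\<close>.\<close>

lemma sum_weight_remove_cycle:
  assumes "finite A" "c \<in> cycle_lists A" "c \<notin> R" "\<And>d. d \<in> R \<Longrightarrow> set c \<inter> set d = {}"
  shows "(\<Sum>p | p permutes A \<and> insert c R \<subseteq> cycles_on A p. weight_on \<theta> A p) =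
    \<theta> (length c) * (\<Sum>q | q permutes (A - set c) \<and> R \<subseteq> cycles_on (A - set c) q.
      weight_on \<theta> (A - set c) q)"
proof -
  have c: "distinct c" "set c \<subseteq> A" "c \<noteq> []"
    using assms(2) by (auto simp: cycle_lists_def)
  \<comment> \<open>Points of \<open>set c\<close> become fixed points, as \<open>permutes\<close>
    demands outside the smaller ground set.\<close>
  define del where "del p = (\<lambda>x. if x \<in> set c then x else p x)" for p :: "nat \<Rightarrow> nat"
  define add where "add q = (\<lambda>x. if x \<in> set c then cycle_map c x else q x)" for q :: "nat \<Rightarrow> nat"
  \<comment> \<open>A nonempty \<open>c\<close> is no tuple over \<open>A - set c\<close>, so
    inserting it contributes a genuinely new factor to the weight.\<close>
  have c_not: "c \<notin> cycles_on (A - set c) q" for q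
    using c(3) by (cases c) (auto simp: cycles_on_def cycle_lists_def)
  have agree: "p x = cycle_map c x" if "c \<in> cycles_on A p" "x \<in> set c" for p x
    using that cycle_map_nth[OF c(1)] by (auto simp: cycles_on_def in_set_conv_nth)
  have ins: "cycles_on A p = insert c (cycles_on (A - set c) (del p))" if "c \<in> cycles_on A p" for p
    using that by (rule cycles_on_eq_insert) (simp add: del_def)
  have "(\<Sum>p | p permutes A \<and> insert c R \<subseteq> cycles_on A p. weight_on \<theta> A p) =
    (\<Sum>q | q permutes (A - set c) \<and> R \<subseteq> cycles_on (A - set c) q.
      \<theta> (length c) * weight_on \<theta> (A - set c) q)"
  proof (rule sum.reindex_bij_witness[where i = add and j = del])
    fix p
    assume "p \<in> {p. p permutes A \<and> insert c R \<subseteq> cycles_on A p}"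
    then have p: "p permutes A" "c \<in> cycles_on A p" "R \<subseteq> cycles_on A p"
      by auto
    show "add (del p) = p"
      using agree[OF p(2)] by (auto simp: add_def del_def)
    have "p ` set c = set c"
      using agree[OF p(2)] bij_betw_cycle_map[OF c(1)]
      by (simp add: bij_betw_def cong: image_cong)
    then have "bij_betw p (A - set c) (A - set c)"
      using p(1) c(2) permutes_imp_bij[OF p(1)]
      by (metis bij_betw_def image_set_diff inj_on_subset Diff_subset permutes_inj)
    then have "bij_betw (del p) (A - set c) (A - set c)"
      by (rule bij_betw_cong[THEN iffD1, rotated]) (simp add: del_def)
    then have "del p permutes (A - set c)"
      using p(1) by (intro bij_imp_permutes) (auto simp: del_def permutes_not_in)
    moreover have "R \<subseteq> cycles_on (A - set c) (del p)"
      using p(3) ins[OF p(2)] assms(3) by auto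
    ultimately show "del p \<in> {q. q permutes (A - set c) \<and> R \<subseteq> cycles_on (A - set c) q}"
      by simp
    show "\<theta> (length c) * weight_on \<theta> (A - set c) (del p) = weight_on \<theta> A p"
      using assms(1) c_not by (simp add: weight_on_def ins[OF p(2)] finite_cycles_on)
  next
    fix q
    assume "q \<in> {q. q permutes (A - set c) \<and> R \<subseteq> cycles_on (A - set c) q}"
    then have q: "q permutes (A - set c)" "R \<subseteq> cycles_on (A - set c) q"
      by auto
    show "del (add q) = q"
      using permutes_not_in[OF q(1)] by (auto simp: add_def del_def)
    have "bij_betw (add q) (set c \<union> (A - set c)) (set c \<union> (A - set c))"
    proof (rule bij_betw_combine)
      show "bij_betw (add q) (set c) (set c)"
        using bij_betw_cycle_map[OF c(1)]
        by (rule bij_betw_cong[THEN iffD1, rotated]) (simp add: add_def)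
      show "bij_betw (add q) (A - set c) (A - set c)"
        using permutes_imp_bij[OF q(1)]
        by (rule bij_betw_cong[THEN iffD1, rotated]) (simp add: add_def)
    qed auto
    moreover have "set c \<union> (A - set c) = A"
      using c(2) by auto
    ultimately have "add q permutes A"
      using q(1) c(2) by (intro bij_imp_permutes) (auto simp: add_def permutes_not_in)
    moreover have cyc: "c \<in> cycles_on A (add q)"
      using assms(2) c(1) by (simp add: cycles_on_def add_def cycle_map_nth)
    moreover have "cycles_on A (add q) = insert c (cycles_on (A - set c) q)"
      using cyc by (rule cycles_on_eq_insert) (simp add: add_def)
    ultimately show "add q \<in> {p. p permutes A \<and> insert c R \<subseteq> cycles_on A p}"
      using q(2) by auto
  qed
  then show ?thesis
    by (simp add: sum_distrib_left)
qed

text \<open>\<open>A\<close> is generalized in the induction because each deletion shrinks the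
  ground set; disjointness keeps the remaining tuples inside it.\<close>

lemma sum_weight_remove_cycles:
  assumes "finite R" "finite A" "R \<subseteq> cycle_lists A" "disjoint_family_on set R"
  shows "(\<Sum>p | p permutes A \<and> R \<subseteq> cycles_on A p. weight_on \<theta> A p) =
    (\<Prod>c\<in>R. \<theta> (length c)) * total_weight \<theta> (A - (\<Union>c\<in>R. set c))"
  using assms
proof (induction R arbitrary: A rule: finite_induct)
  case empty
  then show ?case
    by (simp add: total_weight_def)
next
  case (insert c R)
  have disj: "set c \<inter> set d = {}" if "d \<in> R" for d
    using insert.prems(3) insert.hyps(2) that by (auto simp: disjoint_family_on_def)
  have "R \<subseteq> cycle_lists (A - set c)"
    using insert.prems(2) disj by (fastforce simp: cycle_lists_def)
  moreover have "disjoint_family_on set R"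
    using insert.prems(3) by (rule disjoint_family_on_mono[rotated]) auto
  ultimately have "(\<Sum>q | q permutes (A - set c) \<and> R \<subseteq> cycles_on (A - set c) q.
      weight_on \<theta> (A - set c) q) =
    (\<Prod>c\<in>R. \<theta> (length c)) * total_weight \<theta> (A - set c - (\<Union>c\<in>R. set c))"
    using insert.prems(1) by (intro insert.IH) auto
  moreover have "A - set c - (\<Union>c\<in>R. set c) = A - (\<Union>c\<in>insert c R. set c)"
    by auto
  ultimately show ?case
    using insert.hyps insert.prems disj
    by (subst sum_weight_remove_cycle) auto
qed

text \<open>Distinct cycles of one permutation are disjoint, so the sum is empty. This is what
  reduces symmetric polynomials to disjoint families.\<close>

lemma sum_weight_meeting_cycles_eq_0:
  assumes "\<not> disjoint_family_on set R"
  shows "(\<Sum>p | p permutes A \<and> R \<subseteq> cycles_on A p. weight_on \<theta> A p) = 0"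
proof -
  have "\<not> R \<subseteq> cycles_on A p" for p
    using assms cycles_eq_if_meet[of _ A p] by (fastforce simp: disjoint_family_on_def)
  then show ?thesis
    by simp
qed

section \<open>Invariance of the total weight under increasing relabelling\<close>

lemma map_in_cycle_lists:
  assumes "bij_betw h A B" "strict_mono_on A h" "c \<in> cycle_lists A"
  shows "map h c \<in> cycle_lists B"
proof -
  have c: "c \<noteq> []" "distinct c" "set c \<subseteq> A" "c ! 0 = Min (set c)"
    using assms(3) by (auto simp: cycle_lists_def)
  \<comment> \<open>Monotonicity is essential here: an arbitrary bijection could move the minimum
    away from the front.\<close>
  have "h (c ! 0) \<le> h x" if "x \<in> set c" for x
    using that c strict_mono_on_leD[OF assms(2), of "c ! 0" x] nth_mem[of 0 c] by (auto simp: subset_iff)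
  then have "Min (h ` set c) = h (c ! 0)"
    using c by (intro Min_eqI) auto
  with c assms(1) show ?thesis
    by (auto simp: cycle_lists_def distinct_map bij_betw_def dest: inj_on_subset)
qed

lemma strict_mono_on_inv_into:
  fixes h :: "nat \<Rightarrow> nat"
  assumes "bij_betw h A B" "strict_mono_on A h"
  shows "strict_mono_on B (inv_into A h)"
proof (rule strict_mono_onI)
  fix x y
  assume xy: "x \<in> B" "y \<in> B" "x < y"
  then have "inv_into A h x \<in> A" "inv_into A h y \<in> A"
    "h (inv_into A h x) = x" "h (inv_into A h y) = y"
    using assms(1) by (auto simp: bij_betw_def inv_into_into f_inv_into_f)
  then show "inv_into A h x < inv_into A h y"
    using xy(3) strict_mono_on_leD[OF assms(2)] by (metis leD not_le)
qed

text \<open>Conjugation by \<open>h\<close>, continued by the identity off \<open>B\<close>; in this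
  form it is a bijection from the permutations of \<open>A\<close> to those of
  \<open>B\<close>.\<close>

lemma cycles_on_relabel:
  assumes h: "bij_betw h A B" "strict_mono_on A h" and \<pi>: "\<pi> permutes A"
  shows "cycles_on B (\<lambda>x. if x \<in> B then h (\<pi> (inv_into A h x)) else x) = map h ` cycles_on A \<pi>"
    (is "cycles_on B ?\<pi> = _")
proof (intro equalityI subsetI)
  have inv: "bij_betw (inv_into A h) B A" "strict_mono_on B (inv_into A h)"
    using h by (auto intro: bij_betw_inv_into strict_mono_on_inv_into)
  fix d
  assume d: "d \<in> cycles_on B ?\<pi>"
  define c where "c = map (inv_into A h) d"
  have "c \<in> cycle_lists A"
    using d map_in_cycle_lists[OF inv] by (simp add: cycles_on_def c_def)
  moreover have "\<pi> (c ! j) = c ! (Suc j mod length c)" if j: "j < length c" for j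
  proof -
    have "set d \<subseteq> B" "d \<noteq> []"
      using d by (auto simp: cycles_on_def cycle_lists_def)
    then have in_B: "d ! j \<in> B" "Suc j mod length d < length d"
      using j by (auto simp: c_def subset_iff)
    have "h (\<pi> (c ! j)) = d ! (Suc j mod length d)"
      using d j in_B by (auto simp: cycles_on_def c_def)
    moreover have "\<pi> (c ! j) \<in> A"
      using bij_betwE[OF inv(1)] in_B j permutes_in_image[OF \<pi>] by (simp add: c_def)
    ultimately have "\<pi> (c ! j) = inv_into A h (d ! (Suc j mod length d))"
      using h(1) by (metis bij_betw_inv_into_left)
    then show ?thesis
      using in_B by (simp add: c_def)
  qed
  ultimately have "c \<in> cycles_on A \<pi>"
    by (simp add: cycles_on_def)
  moreover have "d = map h c"
    using d h(1) by (auto simp: c_def cycles_on_def cycle_lists_def bij_betw_inv_into_right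
      subset_iff intro!: nth_equalityI)
  ultimately show "d \<in> map h ` cycles_on A \<pi>"
    by blast
next
  fix d
  assume "d \<in> map h ` cycles_on A \<pi>"
  then obtain c where c: "c \<in> cycles_on A \<pi>" "d = map h c"
    by auto
  have "d \<in> cycle_lists B"
    using c map_in_cycle_lists[OF h] by (simp add: cycles_on_def)
  moreover have "?\<pi> (d ! j) = d ! (Suc j mod length d)" if j: "j < length d" for j
  proof -
    have "c ! j \<in> A" "Suc j mod length c < length c"
      using c j by (auto simp: cycles_on_def cycle_lists_def subset_iff)
    moreover from this have "h (c ! j) \<in> B" "inv_into A h (h (c ! j)) = c ! j"
      using h(1) by (auto simp: bij_betw_def)
    ultimately show ?thesis
      using c j by (simp add: cycles_on_def)
  qed
  ultimately show "d \<in> cycles_on B ?\<pi>"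
    by (simp add: cycles_on_def)
qed

lemma total_weight_relabel:
  assumes h: "bij_betw h A B" "strict_mono_on A h"
  shows "total_weight \<theta> A = total_weight \<theta> B"
proof -
  let ?F = "\<lambda>\<pi> x. if x \<in> B then h (\<pi> (inv_into A h x)) else x"
  have "weight_on \<theta> B (?F \<pi>) = weight_on \<theta> A \<pi>" if "\<pi> permutes A" for \<pi>
  proof -
    have "inj_on (map h) (cycles_on A \<pi>)"
      using h(1) by (intro inj_on_subset[OF inj_on_mapI[of h "cycles_on A \<pi>"]])
        (auto simp: cycles_on_def cycle_lists_def bij_betw_def intro: inj_on_subset)
    then show ?thesis
      by (simp add: weight_on_def cycles_on_relabel[OF h that] prod.reindex)
  qed
  then show ?thesis
    unfolding total_weight_def
    using sum.reindex_bij_betw[OF bij_betw_permutations[OF h(1)], of "weight_on \<theta> B"] by simp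
qed

text \<open>The increasing enumerations relabel both sets to the same initial segment.\<close>

lemma total_weight_cong_card:
  assumes "finite A" "finite B" "card A = card B"
  shows "total_weight \<theta> A = total_weight \<theta> B"
proof -
  obtain h where "bij_betw h {..<card A} A" "strict_mono_on {..<card A} h"
    using ex_bij_betw_strict_mono_card[OF assms(1)] .
  then have "total_weight \<theta> A = total_weight \<theta> {..<card A}"
    by (simp add: total_weight_relabel)
  moreover obtain h where "bij_betw h {..<card B} B" "strict_mono_on {..<card B} h"
    using ex_bij_betw_strict_mono_card[OF assms(2)] .
  then have "total_weight \<theta> B = total_weight \<theta> {..<card B}"
    by (simp add: total_weight_relabel)
  ultimately show ?thesis
    by (simp add: assms(3))
qed

section \<open>Asymptotics of disjoint families of cycles\<close>

definition packings :: "nat list set \<Rightarrow> nat \<Rightarrow> nat list set set" where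
  "packings V r = {R. R \<subseteq> V \<and> card R = r \<and> disjoint_family_on set R}"

text \<open>The elementary symmetric polynomial without the families that have intersecting
  members.\<close>

definition packing_sum :: "(nat list \<Rightarrow> real) \<Rightarrow> nat list set \<Rightarrow> nat \<Rightarrow> real" where
  "packing_sum a V r = (\<Sum>R\<in>packings V r. \<Prod>c\<in>R. a c)"

lemma finite_packings: "finite V \<Longrightarrow> finite (packings V r)"
  unfolding packings_def by (rule finite_subset[of _ "Pow V"]) auto

lemma packing_sum_0: "finite V \<Longrightarrow> packing_sum a V 0 = 1"
proof -
  assume "finite V"
  then have "packings V 0 = {{}}"
    by (auto simp: packings_def disjoint_family_on_def dest: finite_subset)
  then show ?thesis
    by (simp add: packing_sum_def)
qed

text \<open>Count families with one marked member: there are \<open>Suc r\<close> ways to mark, and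
  taking the marked tuple away leaves a family of size \<open>r\<close> that it avoids.\<close>

lemma packing_sum_Suc:
  assumes V: "finite V" "\<And>c. c \<in> V \<Longrightarrow> c \<noteq> []"
  shows "real (Suc r) * packing_sum a V (Suc r) =
    (\<Sum>R\<in>packings V r. (\<Prod>c\<in>R. a c) * (\<Sum>c | c \<in> V \<and> set c \<inter> (\<Union>d\<in>R. set d) = {}. a c))"
proof -
  have fin: "finite R" if "R \<in> packings V r" for R r
    using that V(1) by (auto simp: packings_def dest: finite_subset)
  have "real (Suc r) * packing_sum a V (Suc r) = (\<Sum>R\<in>packings V (Suc r). \<Sum>c\<in>R. \<Prod>d\<in>R. a d)"
    unfolding packing_sum_def sum_distrib_left
    by (intro sum.cong) (auto simp: packings_def)
  also have "\<dots> = (\<Sum>(R, c)\<in>Sigma (packings V (Suc r)) (\<lambda>R. R). \<Prod>d\<in>R. a d)"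
    using V(1) fin by (intro sum.Sigma finite_packings) auto
  also have "\<dots> = (\<Sum>(R, c)\<in>Sigma (packings V r) (\<lambda>R. {c. c \<in> V \<and> set c \<inter> (\<Union>d\<in>R. set d) = {}}).
      (\<Prod>d\<in>R. a d) * a c)"
  proof (rule sum.reindex_bij_witness[where j = "\<lambda>(R, c). (R - {c}, c)" and i = "\<lambda>(R, c). (insert c R, c)"];
      clarsimp)
    fix R c
    assume R: "R \<in> packings V (Suc r)" "c \<in> R"
    show "insert c R = R"
      using R by auto
    show "R - {c} \<in> packings V r \<and> c \<in> V \<and> set c \<inter> (\<Union>d\<in>R - {c}. set d) = {}"
      using R by (auto simp: packings_def disjoint_family_on_def)
    show "(\<Prod>d\<in>R - {c}. a d) * a c = (\<Prod>d\<in>R. a d)"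
      using R fin[OF R(1)] by (simp add: prod.remove mult.commute)
  next
    fix R c
    assume R: "R \<in> packings V r" "c \<in> V" "set c \<inter> (\<Union>d\<in>R. set d) = {}"
    \<comment> \<open>Nonemptiness enters here: the empty list would be disjoint even from a family
      that contains it.\<close>
    have "c \<notin> R"
      using R(3) hd_in_set[OF V(2)[OF R(2)]] by blast
    then show "R - {c} = R"
      by simp
    show "insert c R \<in> packings V (Suc r)"
      using R fin[OF R(1)] \<open>c \<notin> R\<close> by (auto simp: packings_def disjoint_family_on_insert)
  qed
  also have "\<dots> = (\<Sum>R\<in>packings V r. \<Sum>c | c \<in> V \<and> set c \<inter> (\<Union>d\<in>R. set d) = {}. (\<Prod>d\<in>R. a d) * a c)"
    using V(1) by (intro sum.Sigma[symmetric] finite_packings) auto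
  finally show ?thesis
    by (simp add: sum_distrib_left)
qed

text \<open>In the exact recurrence the new tuple avoids the at most \<open>k * r\<close> points
  already used; lifting this restriction changes the inner sum by at most \<delta> for each
  family.\<close>

lemma packing_sum_Suc_approx:
  assumes V: "finite V" "\<And>c. c \<in> V \<Longrightarrow> c \<noteq> []" "\<And>c. c \<in> V \<Longrightarrow> length c \<le> k"
    and a: "\<And>c. c \<in> V \<Longrightarrow> 0 \<le> a c"
    and \<delta>: "\<And>U. finite U \<Longrightarrow> card U \<le> k * r \<Longrightarrow> (\<Sum>c | c \<in> V \<and> set c \<inter> U \<noteq> {}. a c) \<le> \<delta>"
  shows "\<bar>real (Suc r) * packing_sum a V (Suc r) - (\<Sum>c\<in>V. a c) * packing_sum a V r\<bar> \<le>
    \<delta> * packing_sum a V r"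
proof -
  let ?U = "\<lambda>R. \<Union>d\<in>R. set d"
  let ?m = "\<lambda>R. \<Sum>c | c \<in> V \<and> set c \<inter> ?U R \<noteq> {}. a c"
  have m: "0 \<le> ?m R" "?m R \<le> \<delta>" if R: "R \<in> packings V r" for R
  proof -
    have fin: "finite R"
      using R V(1) by (auto simp: packings_def dest: finite_subset)
    have "card (?U R) \<le> (\<Sum>d\<in>R. card (set d))"
      using fin by (rule card_UN_le)
    also have "\<dots> \<le> (\<Sum>d\<in>R. k)"
      using R V(3) by (intro sum_mono order_trans[OF card_length]) (auto simp: packings_def)
    finally show "?m R \<le> \<delta>"
      using R fin by (intro \<delta>) (auto simp: packings_def mult.commute)
    show "0 \<le> ?m R"
      using a by (intro sum_nonneg) auto
  qed
  have "(\<Sum>c | c \<in> V \<and> set c \<inter> ?U R = {}. a c) = (\<Sum>c\<in>V. a c) - ?m R" for R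
  proof -
    have "(\<Sum>c\<in>V. a c) = (\<Sum>c\<in>{c \<in> V. set c \<inter> ?U R = {}} \<union> {c \<in> V. set c \<inter> ?U R \<noteq> {}}. a c)"
      by (intro sum.cong) auto
    also have "\<dots> = (\<Sum>c | c \<in> V \<and> set c \<inter> ?U R = {}. a c) + ?m R"
      using V(1) by (intro sum.union_disjoint) auto
    finally show ?thesis
      by simp
  qed
  then have "real (Suc r) * packing_sum a V (Suc r) - (\<Sum>c\<in>V. a c) * packing_sum a V r =
      - (\<Sum>R\<in>packings V r. (\<Prod>c\<in>R. a c) * ?m R)"
    using packing_sum_Suc[OF V(1,2), of r a]
    by (simp add: packing_sum_def right_diff_distrib sum_subtractf sum_distrib_left mult.commute)
  moreover have nonneg: "0 \<le> (\<Prod>c\<in>R. a c)" if "R \<in> packings V r" for R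
    using that a by (auto simp: packings_def intro!: prod_nonneg)
  then have "0 \<le> (\<Sum>R\<in>packings V r. (\<Prod>c\<in>R. a c) * ?m R)"
    using m(1) by (intro sum_nonneg[of "packings V r"] mult_nonneg_nonneg)
  moreover have "(\<Sum>R\<in>packings V r. (\<Prod>c\<in>R. a c) * ?m R) \<le> (\<Sum>R\<in>packings V r. (\<Prod>c\<in>R. a c) * \<delta>)"
    using m(2) nonneg by (intro sum_mono mult_left_mono)
  ultimately show ?thesis
    by (simp add: packing_sum_def sum_distrib_left mult.commute)
qed

text \<open>Since \<delta> is uniform over the forbidden sets and tends to 0, each step of the
  recurrence contributes a factor \<Lambda> / (r + 1) in the limit.\<close>

lemma tendsto_packing_sum:
  assumes V: "\<And>n. finite (V n)" "\<And>n c. c \<in> V n \<Longrightarrow> c \<noteq> []" "\<And>n c. c \<in> V n \<Longrightarrow> length c \<le> k"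
    and a: "\<And>n c. c \<in> V n \<Longrightarrow> 0 \<le> a n c"
    and \<delta>: "\<And>n K U. finite U \<Longrightarrow> card U \<le> K \<Longrightarrow> (\<Sum>c | c \<in> V n \<and> set c \<inter> U \<noteq> {}. a n c) \<le> \<delta> K n"
    and \<delta>_lim: "\<And>K. \<delta> K \<longlonglongrightarrow> 0"
    and lim: "(\<lambda>n. \<Sum>c\<in>V n. a n c) \<longlonglongrightarrow> \<Lambda>"
  shows "(\<lambda>n. packing_sum (a n) (V n) r) \<longlonglongrightarrow> \<Lambda> ^ r / fact r"
proof (induction r)
  case 0
  then show ?case
    by (simp add: packing_sum_0 V(1))
next
  case (Suc r)
  let ?E = "\<lambda>r n. packing_sum (a n) (V n) r"
  let ?T = "\<lambda>n. \<Sum>c\<in>V n. a n c"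
  have "(\<lambda>n. \<delta> (k * r) n * ?E r n) \<longlonglongrightarrow> 0"
    using tendsto_mult[OF \<delta>_lim Suc] by simp
  then have "(\<lambda>n. real (Suc r) * ?E (Suc r) n - ?T n * ?E r n) \<longlonglongrightarrow> 0"
    by (rule Lim_null_comparison[rotated])
      (use packing_sum_Suc_approx[OF V a \<delta>] in \<open>auto intro!: always_eventually\<close>)
  from tendsto_add[OF this tendsto_mult[OF lim Suc]]
  have "(\<lambda>n. real (Suc r) * ?E (Suc r) n) \<longlonglongrightarrow> \<Lambda> * (\<Lambda> ^ r / fact r)"
    by simp
  from tendsto_divide[OF this tendsto_const[of "real (Suc r)"]] show ?case
    by (simp add: mult.commute del: of_nat_Suc)
qed

section \<open>Tuples and cycles of bounded length on \<open>{1..n}\<close>\<close>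

definition short_cycle_lists :: "nat \<Rightarrow> nat \<Rightarrow> nat list set" where
  "short_cycle_lists k n = {c \<in> cycle_lists {1..n}. length c \<le> k}"

definition short_cycles :: "nat \<Rightarrow> nat \<Rightarrow> (nat \<Rightarrow> nat) \<Rightarrow> nat list set" where
  "short_cycles k n p = {c \<in> cycles_on {1..n} p. length c \<le> k}"

lemma finite_short_cycle_lists: "finite (short_cycle_lists k n)"
  by (simp add: short_cycle_lists_def finite_cycle_lists)

lemma finite_short_cycles: "finite (short_cycles k n p)"
  by (simp add: short_cycles_def finite_cycles_on)

lemma short_cycles_subset: "short_cycles k n p \<subseteq> short_cycle_lists k n"
  by (auto simp: short_cycles_def short_cycle_lists_def cycles_on_def)

lemma subset_short_cycles_iff:
  "R \<subseteq> short_cycles k n p \<longleftrightarrow> R \<subseteq> short_cycle_lists k n \<and> R \<subseteq> cycles_on {1..n} p"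
  by (auto simp: short_cycles_def short_cycle_lists_def cycles_on_def)

text \<open>Counting the complement gives \<open>n ^ m - (n - u) ^ m\<close>, and Bernoulli's
  inequality bounds this by the fraction \<open>m * u / n\<close> of \<open>n ^ m\<close>.\<close>

lemma card_lists_meeting:
  fixes U :: "nat set"
  assumes "finite U" "card U \<le> K" "1 \<le> n"
  shows "real (card {c. length c = m \<and> set c \<subseteq> {1..n} \<and> set c \<inter> U \<noteq> {}}) \<le> real (m * K) / real n * real n ^ m"
proof -
  \<comment> \<open>\<open>U\<close> may reach outside \<open>{1..n}\<close>. Intersecting gives
    \<open>u \<le> n\<close>, so that the argument in Bernoulli's inequality is at least -1.\<close>
  define u where "u = card (U \<inter> {1..n})"
  have u: "u \<le> n" "u \<le> K"
    using card_mono[of "{1..n}" "U \<inter> {1..n}"] card_mono[of U "U \<inter> {1..n}"] assms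
    by (auto simp: u_def)
  let ?L = "\<lambda>A. {c :: nat list. set c \<subseteq> A \<and> length c = m}"
  have "{c. length c = m \<and> set c \<subseteq> {1..n} \<and> set c \<inter> U \<noteq> {}} = ?L {1..n} - ?L ({1..n} - U)"
    by auto
  moreover have "card (?L {1..n} - ?L ({1..n} - U)) = card (?L {1..n}) - card (?L ({1..n} - U))"
    by (intro card_Diff_subset finite_lists_length_eq) auto
  moreover have "card ({1..n} - U) = n - u"
    by (simp add: card_Diff_subset_Int u_def Int_commute)
  moreover have "(n - u) ^ m \<le> n ^ m"
    by (intro power_mono) auto
  ultimately have "real (card {c. length c = m \<and> set c \<subseteq> {1..n} \<and> set c \<inter> U \<noteq> {}}) =
      real n ^ m - (real n - real u) ^ m"
    using u(1) by (simp add: card_lists_length_eq of_nat_diff)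
  also have "real n - real u = real n * (1 + - (real u / real n))"
    using assms(3) by (simp add: field_simps)
  also have "real n ^ m - (real n * (1 + - (real u / real n))) ^ m =
      (1 - (1 + - (real u / real n)) ^ m) * real n ^ m"
    by (subst power_mult_distrib) (simp only: left_diff_distrib mult_1_left mult.commute[of "real n ^ m"])
  also have "\<dots> \<le> (real m * (real u / real n)) * real n ^ m"
    using Bernoulli_inequality[of "- (real u / real n)" m] u assms(3)
    by (intro mult_right_mono) (auto simp: field_simps)
  also have "\<dots> \<le> (real m * (real K / real n)) * real n ^ m"
    using u(2) by (intro mult_right_mono mult_left_mono divide_right_mono) auto
  finally show ?thesis
    by simp
qed

text \<open>Forgetting distinctness and the minimum condition leaves all lists that meet
  \<open>U\<close>, whose number is O(n^(m-1)) against the normalization n^m.\<close>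

lemma sum_meeting_le:
  assumes \<theta>: "\<forall>j\<ge>1. 0 \<le> \<theta> j"
    and g: "\<forall>c\<in>short_cycle_lists k n. 0 \<le> g c \<and> g c \<le> 1"
    and U: "finite U" "card U \<le> K"
  shows "(\<Sum>c | c \<in> short_cycle_lists k n \<and> set c \<inter> U \<noteq> {}. \<theta> (length c) * g c / real n ^ length c) \<le>
    (\<Sum>m=1..k. \<theta> m * (real (m * K) / real n))"
\<comment> \<open>For \<open>n = 0\<close> there are no tuples, and the right-hand side is 0 by
  \<open>x / 0 = 0\<close>.\<close>
proof (cases "n = 0")
  case True
  then have "short_cycle_lists k n = {}"
    by (auto simp: short_cycle_lists_def cycle_lists_def)
  with True show ?thesis
    by simp
next
  case False
  let ?S = "{c. c \<in> short_cycle_lists k n \<and> set c \<inter> U \<noteq> {}}"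
  have len: "1 \<le> length c" "length c \<le> k" if "c \<in> short_cycle_lists k n" for c
    using that by (auto simp: short_cycle_lists_def cycle_lists_def Suc_le_eq)
  have "(\<Sum>c\<in>?S. \<theta> (length c) * g c / real n ^ length c) =
      (\<Sum>m=1..k. \<Sum>c | c \<in> ?S \<and> length c = m. \<theta> (length c) * g c / real n ^ length c)"
    using len finite_short_cycle_lists by (intro sum.group[symmetric]) auto
  also have "\<dots> \<le> (\<Sum>m=1..k. \<theta> m * (real (m * K) / real n))"
  proof (rule sum_mono)
    fix m
    assume m: "m \<in> {1..k}"
    let ?C = "{c. length c = m \<and> set c \<subseteq> {1..n} \<and> set c \<inter> U \<noteq> {}}"
    have finC: "finite ?C"
      by (rule finite_subset[OF _ finite_lists_length_eq[of "{1..n}" m]]) auto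
    have "(\<Sum>c | c \<in> ?S \<and> length c = m. \<theta> (length c) * g c / real n ^ length c) \<le>
        (\<Sum>c | c \<in> ?S \<and> length c = m. \<theta> m / real n ^ m)"
      using m g \<theta>[rule_format, of m] by (intro sum_mono) (auto intro!: divide_right_mono mult_left_le)
    also have "\<dots> \<le> (\<Sum>c\<in>?C. \<theta> m / real n ^ m)"
      using m \<theta>[rule_format, of m] finC
      by (intro sum_mono2) (auto simp: short_cycle_lists_def cycle_lists_def)
    also have "\<dots> = \<theta> m / real n ^ m * real (card ?C)"
      by simp
    also have "\<dots> \<le> \<theta> m / real n ^ m * (real (m * K) / real n * real n ^ m)"
      using m \<theta>[rule_format, of m] False U by (intro mult_left_mono card_lists_meeting) auto
    also have "\<dots> = \<theta> m * (real (m * K) / real n)"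
      using False by simp
    finally show "(\<Sum>c | c \<in> ?S \<and> length c = m. \<theta> (length c) * g c / real n ^ length c) \<le>
      \<theta> m * (real (m * K) / real n)" .
  qed
  finally show ?thesis .
qed

lemma tendsto_short_packing_sum:
  assumes \<theta>: "\<forall>j\<ge>1. 0 \<le> \<theta> j"
    and g: "\<forall>n. \<forall>c\<in>short_cycle_lists k n. 0 \<le> g n c \<and> g n c \<le> 1"
    and lim: "(\<lambda>n. \<Sum>c\<in>short_cycle_lists k n. \<theta> (length c) * g n c / real n ^ length c) \<longlonglongrightarrow> \<Lambda>"
  shows "(\<lambda>n. packing_sum (\<lambda>c. \<theta> (length c) * g n c / real n ^ length c) (short_cycle_lists k n) r)
    \<longlonglongrightarrow> \<Lambda> ^ r / fact r"
proof (rule tendsto_packing_sum[OF _ _ _ _ _ _ lim, where k = k])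
  show "(\<Sum>c | c \<in> short_cycle_lists k n \<and> set c \<inter> U \<noteq> {}. \<theta> (length c) * g n c / real n ^ length c) \<le>
    (\<Sum>m=1..k. \<theta> m * (real (m * K) / real n))" if "finite U" "card U \<le> K" for n K and U :: "nat set"
    using \<theta> g[rule_format] that by (intro sum_meeting_le) auto
  have "(\<lambda>n. \<Sum>m=1..k. \<theta> m * (real (m * K) / real n)) \<longlonglongrightarrow> (\<Sum>m=1..k. \<theta> m * 0)" for K
    by (intro tendsto_sum tendsto_mult tendsto_const lim_const_over_n)
  then show "(\<lambda>n. \<Sum>m=1..k. \<theta> m * (real (m * K) / real n)) \<longlonglongrightarrow> 0" for K
    by simp
  show "0 \<le> \<theta> (length c) * g n c / real n ^ length c" if "c \<in> short_cycle_lists k n" for n c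
    using that g[rule_format, OF that] \<theta>[rule_format, of "length c"]
    by (auto simp: short_cycle_lists_def cycle_lists_def Suc_le_eq)
qed (auto simp: finite_short_cycle_lists, auto simp: short_cycle_lists_def cycle_lists_def)

section \<open>Positivity and asymptotics of the normalization\<close>

lemma eventually_perm_norm_pos:
  assumes \<theta>: "\<forall>j\<ge>1. 0 \<le> \<theta> j"
    and h: "(\<lambda>n. perm_norm \<theta> (n - 1) / perm_norm \<theta> n) \<longlonglongrightarrow> 1"
  shows "\<forall>\<^sub>F n in sequentially. 0 < perm_norm \<theta> n"
proof -
  have "0 \<le> perm_norm \<theta> n" for n
    unfolding perm_norm_def cycle_weight_eq_weight_on
    by (intro divide_nonneg_nonneg sum_nonneg weight_on_nonneg[OF \<theta>]) simp
  \<comment> \<open>A vanishing denominator would make the quotient 0 by \<open>x / 0 = 0\<close>,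
    so a positive quotient forces a nonzero normalization.\<close>
  moreover have "\<forall>\<^sub>F n in sequentially. 0 < perm_norm \<theta> (n - 1) / perm_norm \<theta> n"
    using h by (rule order_tendstoD(1)) simp
  ultimately show ?thesis
    by (elim eventually_mono) (auto simp: zero_less_divide_iff order.strict_iff_order)
qed

text \<open>Total weights are normalizations times factorials, so passing from \<open>M\<close> to
  \<open>Suc M\<close> multiplies by a shifted ratio of normalizations and by
  \<open>n / (n - M)\<close>; both tend to 1.\<close>

lemma tendsto_total_weight_ratio:
  assumes pos: "\<forall>\<^sub>F n in sequentially. 0 < perm_norm \<theta> n"
    and h: "(\<lambda>n. perm_norm \<theta> (n - 1) / perm_norm \<theta> n) \<longlonglongrightarrow> 1"
  shows "(\<lambda>n. total_weight \<theta> {1..n - M} * real n ^ M / total_weight \<theta> {1..n}) \<longlonglongrightarrow> 1"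
proof (induction M)
  case 0
  have "\<forall>\<^sub>F n in sequentially. 1 = total_weight \<theta> {1..n - 0} * real n ^ 0 / total_weight \<theta> {1..n}"
    using pos by eventually_elim (simp flip: perm_norm_eq_total_weight del: One_nat_def)
  then show ?case
    by (rule tendsto_eventually[OF eventually_mono]) simp
next
  case (Suc M)
  have "(\<lambda>n. perm_norm \<theta> (n - M - 1) / perm_norm \<theta> (n - M)) \<longlonglongrightarrow> 1"
    using filterlim_compose[OF h filterlim_minus_const_nat_at_top[of M]] by simp
  moreover have "(\<lambda>n. real n / real (n - M)) \<longlonglongrightarrow> 1"
  proof (rule Lim_transform_eventually)
    show "(\<lambda>n. inverse (1 - real M / real n)) \<longlonglongrightarrow> 1"
      by (auto intro!: tendsto_eq_intros lim_const_over_n)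
    show "\<forall>\<^sub>F n in sequentially. inverse (1 - real M / real n) = real n / real (n - M)"
      using eventually_gt_at_top[of M] by eventually_elim (simp add: field_simps of_nat_diff)
  qed
  ultimately have "(\<lambda>n. total_weight \<theta> {1..n - M} * real n ^ M / total_weight \<theta> {1..n} *
      (perm_norm \<theta> (n - M - 1) / perm_norm \<theta> (n - M)) * (real n / real (n - M))) \<longlonglongrightarrow> 1 * 1 * 1"
    by (intro tendsto_mult Suc)
  moreover have "\<forall>\<^sub>F n in sequentially. 0 < perm_norm \<theta> (n - M)"
    by (rule eventually_compose_filterlim[OF pos filterlim_minus_const_nat_at_top])
  then have "\<forall>\<^sub>F n in sequentially. total_weight \<theta> {1..n - M} * real n ^ M / total_weight \<theta> {1..n} *
      (perm_norm \<theta> (n - M - 1) / perm_norm \<theta> (n - M)) * (real n / real (n - M)) =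
      total_weight \<theta> {1..n - Suc M} * real n ^ Suc M / total_weight \<theta> {1..n}"
    using pos eventually_gt_at_top[of M]
  proof eventually_elim
    case (elim n)
    \<comment> \<open>Here \<open>a\<close> and \<open>b\<close> stand for the normalizations at
      \<open>n - M\<close> and \<open>n - Suc M\<close>, \<open>d\<close> for \<open>n - M\<close>,
      \<open>x\<close> for \<open>fact (n - Suc M)\<close>, \<open>y\<close> for
      \<open>n ^ M\<close>, \<open>z\<close> for \<open>n\<close> and \<open>w\<close> for the total
      weight at \<open>n\<close>.\<close>
    have cancel: "a * (d * x) * y / w * (b / a) * (z / d) = b * x * (z * y) / w"
      if "a \<noteq> 0" "d \<noteq> 0" for a b d w x y z :: real
      using that by simp
    have "n - M = Suc (n - Suc M)"
      using elim by simp
    then have fact: "(fact (n - M) :: real) = real (n - M) * fact (n - Suc M)"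
      by (metis fact_Suc)
    have pred: "n - M - 1 = n - Suc M"
      by simp
    show ?case
      unfolding perm_norm_eq_total_weight[symmetric] fact pred power_Suc
      using elim by (intro cancel) auto
  qed
  ultimately show ?case
    by (simp add: Lim_transform_eventually)
qed

text \<open>After exchanging the sums over permutations and families only disjoint families survive;
  their cycles are deleted and the rest is relabelled. The power of \<open>n\<close> is introduced
  to normalize each tuple of length \<open>m\<close> by \<open>n ^ m\<close>.\<close>

lemma sum_weight_esym:
  fixes k n r :: nat and g :: "nat list \<Rightarrow> real"
  assumes "0 < n"
  shows "(\<Sum>p | p permutes {1..n}. weight_on \<theta> {1..n} p * esym g (short_cycles k n p) r) =
    (\<Sum>R\<in>packings (short_cycle_lists k n) r. (\<Prod>c\<in>R. \<theta> (length c) * g c / real n ^ length c) *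
      (total_weight \<theta> {1..n - card (\<Union>c\<in>R. set c)} * real n ^ card (\<Union>c\<in>R. set c)))"
proof -
  let ?a = "\<lambda>c. \<theta> (length c) * g c / real n ^ length c"
  let ?V = "short_cycle_lists k n" and ?P = "{p. p permutes {1..n}}" and ?w = "weight_on \<theta> {1..n}"
  let ?S = "{R. R \<subseteq> ?V \<and> card R = r}"
  let ?f = "\<lambda>R. (\<Prod>c\<in>R. g c) * (\<Sum>p | p permutes {1..n} \<and> R \<subseteq> cycles_on {1..n} p. ?w p)"
  have finS: "finite ?S"
    by (rule finite_subset[of _ "Pow ?V"]) (auto simp: finite_short_cycle_lists)
  have "(\<Sum>p\<in>?P. ?w p * esym g (short_cycles k n p) r) =
      (\<Sum>p\<in>?P. \<Sum>R | R \<in> ?S \<and> R \<subseteq> cycles_on {1..n} p. (\<Prod>c\<in>R. g c) * ?w p)"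
    unfolding esym_def sum_distrib_left
    by (intro sum.cong) (auto simp: subset_short_cycles_iff mult.commute)
  also have "\<dots> = (\<Sum>R\<in>?S. \<Sum>p | p \<in> ?P \<and> R \<subseteq> cycles_on {1..n} p. (\<Prod>c\<in>R. g c) * ?w p)"
    by (rule sum.swap_restrict) (use finS finite_permutations in auto)
  also have "\<dots> = (\<Sum>R\<in>?S. ?f R)"
    by (simp add: sum_distrib_left)
  also have "\<dots> = (\<Sum>R\<in>packings ?V r. ?f R)"
    using finS sum_weight_meeting_cycles_eq_0
    by (intro sum.mono_neutral_right) (auto simp: packings_def)
  also have "\<dots> = (\<Sum>R\<in>packings ?V r. (\<Prod>c\<in>R. ?a c) *
      (total_weight \<theta> {1..n - card (\<Union>c\<in>R. set c)} * real n ^ card (\<Union>c\<in>R. set c)))"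
  proof (rule sum.cong[OF refl])
    fix R
    assume R: "R \<in> packings ?V r"
    let ?U = "\<Union>c\<in>R. set c"
    have R': "finite R" "R \<subseteq> cycle_lists {1..n}" "disjoint_family_on set R"
      using R finite_short_cycle_lists by (auto simp: packings_def short_cycle_lists_def dest: finite_subset)
    have "card ?U = (\<Sum>c\<in>R. card (set c))"
      using R' by (intro card_UN_disjoint') auto
    also have "\<dots> = (\<Sum>c\<in>R. length c)"
      using R'(2) by (intro sum.cong) (auto simp: cycle_lists_def distinct_card)
    finally have card_U: "real n ^ card ?U = (\<Prod>c\<in>R. real n ^ length c)"
      by (simp add: power_sum)
    have "?U \<subseteq> {1..n}"
      using R'(2) by (auto simp: cycle_lists_def)
    then have "card ({1..n} - ?U) = card {1..n - card ?U}"
      by (simp add: card_Diff_subset finite_subset)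
    then have "total_weight \<theta> ({1..n} - ?U) = total_weight \<theta> {1..n - card ?U}"
      by (intro total_weight_cong_card) auto
    then have "?f R = (\<Prod>c\<in>R. g c) * ((\<Prod>c\<in>R. \<theta> (length c)) * total_weight \<theta> {1..n - card ?U})"
      using R' by (simp add: sum_weight_remove_cycles)
    also have "\<dots> = (\<Prod>c\<in>R. ?a c) * (total_weight \<theta> {1..n - card ?U} * real n ^ card ?U)"
      using assms(1) R'(1) by (simp add: prod.distrib prod_dividef card_U)
    finally show "?f R = (\<Prod>c\<in>R. ?a c) * (total_weight \<theta> {1..n - card ?U} * real n ^ card ?U)" .
  qed
  finally show ?thesis .
qed

text \<open>A packing of \<open>r\<close> tuples covers at most \<open>r * k\<close> points, so the
  finite sum \<open>?\<epsilon> n\<close> controls the weight ratio for all packings at once,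
  although their number grows with \<open>n\<close>.\<close>

lemma tendsto_expected_esym:
  assumes \<theta>: "\<forall>j\<ge>1. 0 \<le> \<theta> j"
    and h: "(\<lambda>n. perm_norm \<theta> (n - 1) / perm_norm \<theta> n) \<longlonglongrightarrow> 1"
    and g: "\<forall>n. \<forall>c\<in>short_cycle_lists k n. 0 \<le> g n c \<and> g n c \<le> 1"
    and lim: "(\<lambda>n. \<Sum>c\<in>short_cycle_lists k n. \<theta> (length c) * g n c / real n ^ length c) \<longlonglongrightarrow> \<Lambda>"
  shows "(\<lambda>n. (\<Sum>p | p permutes {1..n}. weight_on \<theta> {1..n} p * esym (g n) (short_cycles k n p) r) /
    total_weight \<theta> {1..n}) \<longlonglongrightarrow> \<Lambda> ^ r / fact r"
proof -
  let ?a = "\<lambda>n c. \<theta> (length c) * g n c / real n ^ length c"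
  let ?V = "\<lambda>n. short_cycle_lists k n"
  let ?E = "\<lambda>n. packing_sum (?a n) (?V n) r"
  let ?\<rho> = "\<lambda>n M. total_weight \<theta> {1..n - M} * real n ^ M / total_weight \<theta> {1..n}"
  let ?P = "\<lambda>n. (\<Sum>p | p permutes {1..n}. weight_on \<theta> {1..n} p * esym (g n) (short_cycles k n p) r) /
    total_weight \<theta> {1..n}"
  let ?\<epsilon> = "\<lambda>n. \<Sum>M\<le>r * k. \<bar>?\<rho> n M - 1\<bar>"
  have E: "?E \<longlonglongrightarrow> \<Lambda> ^ r / fact r"
    using \<theta> g lim by (rule tendsto_short_packing_sum)
  have "?\<epsilon> \<longlonglongrightarrow> (\<Sum>M\<le>r * k. \<bar>1 - 1\<bar>)"
    using tendsto_total_weight_ratio[OF eventually_perm_norm_pos[OF \<theta> h] h]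
    by (intro tendsto_intros)
  then have bound_lim: "(\<lambda>n. ?E n * ?\<epsilon> n) \<longlonglongrightarrow> 0"
    using tendsto_mult[OF E, of ?\<epsilon> 0] by simp
  have "\<bar>?P n - ?E n\<bar> \<le> ?E n * ?\<epsilon> n" if "0 < n" for n
  proof -
    let ?M = "\<lambda>R. card (\<Union>c\<in>R. set c)"
    have nonneg: "0 \<le> (\<Prod>c\<in>R. ?a n c)" if "R \<in> packings (?V n) r" for R
    proof (rule prod_nonneg)
      fix c
      assume "c \<in> R"
      then have "c \<in> ?V n"
        using that by (auto simp: packings_def)
      then show "0 \<le> ?a n c"
        using g[rule_format, of c n] \<theta>[rule_format, of "length c"] by (auto simp: short_cycle_lists_def cycle_lists_def Suc_le_eq)
    qed
    have M: "?M R \<le> r * k" if R: "R \<in> packings (?V n) r" for R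
    proof -
      have "?M R \<le> (\<Sum>c\<in>R. card (set c))"
        using R finite_short_cycle_lists by (intro card_UN_le) (auto simp: packings_def dest: finite_subset)
      also have "\<dots> \<le> (\<Sum>c\<in>R. k)"
        using R by (intro sum_mono order_trans[OF card_length]) (auto simp: packings_def short_cycle_lists_def)
      finally show ?thesis
        using R by (simp add: packings_def)
    qed
    have "?P n - ?E n = (\<Sum>R\<in>packings (?V n) r. (\<Prod>c\<in>R. ?a n c) * (?\<rho> n (?M R) - 1))"
      unfolding sum_weight_esym[OF that] packing_sum_def
      by (simp add: sum_divide_distrib right_diff_distrib sum_subtractf)
    then have "\<bar>?P n - ?E n\<bar> = \<bar>\<Sum>R\<in>packings (?V n) r. (\<Prod>c\<in>R. ?a n c) * (?\<rho> n (?M R) - 1)\<bar>"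
      by (rule arg_cong)
    also have "\<dots> \<le> (\<Sum>R\<in>packings (?V n) r. \<bar>(\<Prod>c\<in>R. ?a n c) * (?\<rho> n (?M R) - 1)\<bar>)"
      by (rule sum_abs)
    also have "\<dots> \<le> (\<Sum>R\<in>packings (?V n) r. (\<Prod>c\<in>R. ?a n c) * ?\<epsilon> n)"
    proof (rule sum_mono)
      fix R
      assume R: "R \<in> packings (?V n) r"
      have "\<bar>?\<rho> n (?M R) - 1\<bar> \<le> ?\<epsilon> n"
        using M[OF R]
        by (rule member_le_sum[where f = "\<lambda>M. \<bar>?\<rho> n M - 1\<bar>", OF iffD2[OF atMost_iff]])
          (rule abs_ge_zero, rule finite_atMost)
      from mult_left_mono[OF this nonneg[OF R]]
      show "\<bar>(\<Prod>c\<in>R. ?a n c) * (?\<rho> n (?M R) - 1)\<bar> \<le> (\<Prod>c\<in>R. ?a n c) * ?\<epsilon> n"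
        unfolding abs_mult abs_of_nonneg[OF nonneg[OF R]] .
    qed
    also have "\<dots> = ?E n * ?\<epsilon> n"
      by (simp only: packing_sum_def sum_distrib_right)
    finally show ?thesis .
  qed
  then have "\<forall>\<^sub>F n in sequentially. norm (?P n - ?E n) \<le> ?E n * ?\<epsilon> n"
    unfolding real_norm_def by (intro eventually_mono[OF eventually_gt_at_top[of 0]])
  from tendsto_add[OF Lim_null_comparison[OF this bound_lim] E] show ?thesis
    by simp
qed

text \<open>Bonferroni's inequality holds for every single permutation, and averaging with
  nonnegative weights preserves it.\<close>

proposition tendsto_expected_product:
  assumes \<theta>: "\<forall>j\<ge>1. 0 \<le> \<theta> j"
    and h: "(\<lambda>n. perm_norm \<theta> (n - 1) / perm_norm \<theta> n) \<longlonglongrightarrow> 1"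
    and g: "\<forall>n. \<forall>c\<in>short_cycle_lists k n. 0 \<le> g n c \<and> g n c \<le> 1"
    and lim: "(\<lambda>n. \<Sum>c\<in>short_cycle_lists k n. \<theta> (length c) * g n c / real n ^ length c) \<longlonglongrightarrow> \<Lambda>"
  shows "(\<lambda>n. (\<Sum>p | p permutes {1..n}. weight_on \<theta> {1..n} p * (\<Prod>c\<in>short_cycles k n p. 1 - g n c)) /
    total_weight \<theta> {1..n}) \<longlonglongrightarrow> exp (- \<Lambda>)"
proof (rule tendsto_exp_if_bonferroni[OF tendsto_expected_esym[OF \<theta> h g lim]])
  fix s
  let ?w = "\<lambda>n. weight_on \<theta> {1..n}" and ?W = "\<lambda>n. total_weight \<theta> {1..n}"
  let ?e = "\<lambda>n p. esym (g n) (short_cycles k n p)"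
  let ?d = "\<lambda>n p. (\<Prod>c\<in>short_cycles k n p. 1 - g n c)"
  show "\<forall>\<^sub>F n in sequentially.
      \<bar>(\<Sum>p | p permutes {1..n}. ?w n p * ?d n p) / ?W n -
        (\<Sum>r\<le>s. (- 1) ^ r * ((\<Sum>p | p permutes {1..n}. ?w n p * ?e n p r) / ?W n))\<bar>
      \<le> (\<Sum>p | p permutes {1..n}. ?w n p * ?e n p (Suc s)) / ?W n"
    using eventually_perm_norm_pos[OF \<theta> h]
  proof eventually_elim
    case (elim n)
    let ?Q = "{p. p permutes {1..n}}"
    have W: "0 < ?W n"
      using elim by (simp flip: perm_norm_eq_total_weight del: One_nat_def)
    have "(\<Sum>r\<le>s. (- 1) ^ r * ((\<Sum>p\<in>?Q. ?w n p * ?e n p r) / ?W n)) =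
        (\<Sum>p\<in>?Q. ?w n p * (\<Sum>r\<le>s. (- 1) ^ r * ?e n p r)) / ?W n"
      unfolding sum_distrib_left sum_divide_distrib
      by (subst sum.swap) (simp add: mult_ac)
    then have "(\<Sum>p\<in>?Q. ?w n p * ?d n p) / ?W n -
        (\<Sum>r\<le>s. (- 1) ^ r * ((\<Sum>p\<in>?Q. ?w n p * ?e n p r) / ?W n)) =
        (\<Sum>p\<in>?Q. ?w n p * (?d n p - (\<Sum>r\<le>s. (- 1) ^ r * ?e n p r))) / ?W n"
      by (simp add: right_diff_distrib sum_subtractf diff_divide_distrib)
    then have "\<bar>(\<Sum>p\<in>?Q. ?w n p * ?d n p) / ?W n -
        (\<Sum>r\<le>s. (- 1) ^ r * ((\<Sum>p\<in>?Q. ?w n p * ?e n p r) / ?W n))\<bar> =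
        \<bar>(\<Sum>p\<in>?Q. ?w n p * (?d n p - (\<Sum>r\<le>s. (- 1) ^ r * ?e n p r))) / ?W n\<bar>"
      by (rule arg_cong)
    also have "\<dots> \<le> (\<Sum>p\<in>?Q. \<bar>?w n p * (?d n p - (\<Sum>r\<le>s. (- 1) ^ r * ?e n p r))\<bar>) / ?W n"
      using W by (simp add: abs_divide divide_right_mono sum_abs)
    also have "\<dots> \<le> (\<Sum>p\<in>?Q. ?w n p * ?e n p (Suc s)) / ?W n"
    proof (intro divide_right_mono sum_mono)
      fix p
      have "\<bar>?d n p - (\<Sum>r\<le>s. (- 1) ^ r * ?e n p r)\<bar> \<le> ?e n p (Suc s)"
        using g short_cycles_subset[of k n p] by (intro bonferroni[OF finite_short_cycles]) auto
      from mult_left_mono[OF this weight_on_nonneg[OF \<theta>]]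
      show "\<bar>?w n p * (?d n p - (\<Sum>r\<le>s. (- 1) ^ r * ?e n p r))\<bar> \<le> ?w n p * ?e n p (Suc s)"
        unfolding abs_mult abs_of_nonneg[OF weight_on_nonneg[OF \<theta>]] .
    qed (use W in simp)
    finally show ?case .
  qed
qed

section \<open>Riemann sums over the cube\<close>

abbreviation lborel_on :: "nat \<Rightarrow> (nat \<Rightarrow> real) measure" where
  "lborel_on m \<equiv> \<Pi>\<^sub>M j\<in>{..<m}. lborel"

text \<open>The upper corner is \<open>c / n\<close> and the lower faces are left out, so the cells
  of the lists over \<open>{1..n}\<close> partition (0,1]^m and rounding up finds the cell of a
  point.\<close>

definition grid_cell :: "nat \<Rightarrow> nat list \<Rightarrow> (nat \<Rightarrow> real) set" where
  "grid_cell n c = (\<Pi>\<^sub>E j\<in>{..<length c}. {(real (c ! j) - 1) / real n <.. real (c ! j) / real n})"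

definition grid_index :: "nat \<Rightarrow> nat \<Rightarrow> (nat \<Rightarrow> real) \<Rightarrow> nat list" where
  "grid_index m n x = map (\<lambda>j. nat \<lceil>real n * x j\<rceil>) [0..<m]"

definition half_open_cube :: "nat \<Rightarrow> (nat \<Rightarrow> real) set" where
  "half_open_cube m = {..<m} \<rightarrow>\<^sub>E {0<..1}"

lemma tendsto_fun_if_components:
  fixes y :: "nat \<Rightarrow> nat \<Rightarrow> real"
  assumes "\<And>j. (\<lambda>n. y n j) \<longlonglongrightarrow> x j"
  shows "y \<longlonglongrightarrow> x"
proof -
  have "limitin (product_topology (\<lambda>_. euclidean) UNIV) y x sequentially"
    unfolding limitin_componentwise using assms by simp
  then show ?thesis
    by (simp add: euclidean_product_topology)
qed

lemma emeasure_box: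
  assumes "\<And>j. j < m \<Longrightarrow> l j \<le> u j"
  shows "emeasure (lborel_on m) (\<Pi>\<^sub>E j\<in>{..<m}. {l j<..u j}) = ennreal (\<Prod>j<m. u j - l j)"
    and "emeasure (lborel_on m) (\<Pi>\<^sub>E j\<in>{..<m}. {l j..u j}) = ennreal (\<Prod>j<m. u j - l j)"
proof -
  interpret product_sigma_finite "\<lambda>_. lborel :: real measure" ..
  show "emeasure (lborel_on m) (\<Pi>\<^sub>E j\<in>{..<m}. {l j<..u j}) = ennreal (\<Prod>j<m. u j - l j)"
    using assms by (simp add: emeasure_PiM) (intro prod_ennreal, simp)
  show "emeasure (lborel_on m) (\<Pi>\<^sub>E j\<in>{..<m}. {l j..u j}) = ennreal (\<Prod>j<m. u j - l j)"
    using assms by (simp add: emeasure_PiM) (intro prod_ennreal, simp)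
qed

lemma sets_box:
  "(\<Pi>\<^sub>E j\<in>{..<m}. {l j<..u j}) \<in> sets (lborel_on m)" "(\<Pi>\<^sub>E j\<in>{..<m}. {l j..u j}) \<in> sets (lborel_on m)"
  for l u :: "nat \<Rightarrow> real"
  by (rule sets_PiM_I_finite; simp)+

text \<open>Integration takes place on extensional functions on \<open>{..<m}\<close>, whereas
  continuity refers to the full function type. The coordinates from \<open>m\<close> on are
  constantly \<open>undefined\<close>, which makes the inclusion measurable.\<close>

lemma measurable_lborel_on_borel:
  "(\<lambda>x. x) \<in> measurable (lborel_on m) (borel :: (nat \<Rightarrow> real) measure)"
proof -
  have "(\<lambda>x. x) \<in> measurable (lborel_on m) (\<Pi>\<^sub>M j\<in>UNIV. (borel :: real measure))"
  proof (rule measurable_PiM_single')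
    fix j :: nat
    show "(\<lambda>x. x j) \<in> measurable (lborel_on m) borel"
    proof (cases "j < m")
      case True
      then have "(\<lambda>x. x j) \<in> measurable (lborel_on m) lborel"
        by (intro measurable_component_singleton) simp
      then show ?thesis
        by simp
    next
      case False
      have "(\<lambda>x. x j) \<in> measurable (lborel_on m) borel \<longleftrightarrow>
          (\<lambda>x. undefined :: real) \<in> measurable (lborel_on m) borel"
        using False by (intro measurable_cong) (auto simp: space_PiM PiE_def extensional_def)
      then show ?thesis
        by simp
    qed
  qed auto
  then show ?thesis
    by (simp add: measurable_cong_sets[OF refl sets_PiM_equal_borel])
qed

lemma min_first_cube_iff:
  assumes "1 \<le> m"
  shows "x \<in> min_first_cube m \<longleftrightarrow> x \<in> {..<m} \<rightarrow>\<^sub>E {0..1} \<and> (\<forall>j<m. x 0 \<le> x j)"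
proof -
  have "Min (x ` {..<m}) = x 0 \<longleftrightarrow> (\<forall>j<m. x 0 \<le> x j)"
    using assms by (subst Min_eq_iff) (auto simp: lessThan_empty_iff)
  then show ?thesis
    by (simp add: min_first_cube_def)
qed

lemma sets_min_first_cube:
  assumes "1 \<le> m"
  shows "min_first_cube m \<in> sets (lborel_on m)"
proof -
  let ?C = "\<Pi>\<^sub>E j\<in>{..<m}. {0..1 :: real}"
  have "min_first_cube m = ?C \<inter> (\<Inter>j<m. {x \<in> space (lborel_on m). x 0 \<le> x j})"
    using assms by (auto simp: min_first_cube_iff space_PiM PiE_def Pi_iff)
  moreover have "{x \<in> space (lborel_on m). x 0 \<le> x j} \<in> sets (lborel_on m)" if "j < m" for j
  proof -
    have "(\<lambda>x. x i) \<in> borel_measurable (lborel_on m)" if "i < m" for i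
      using measurable_component_singleton[of i "{..<m}" "\<lambda>_. lborel"] that by simp
    then show ?thesis
      using that assms by (intro borel_measurable_le) auto
  qed
  ultimately show ?thesis
    using assms by (auto intro!: sets.Int sets.countable_INT' simp: lessThan_empty_iff)
qed

lemma borel_measurable_on_min_first_cube:
  fixes G :: "(nat \<Rightarrow> real) \<Rightarrow> real"
  assumes "1 \<le> m" "continuous_on (min_first_cube m) G"
  shows "(\<lambda>x. indicator (min_first_cube m) x * G x) \<in> borel_measurable (lborel_on m)"
proof -
  let ?R = "restrict_space (lborel_on m) (min_first_cube m)"
  have "(\<lambda>x. x) \<in> measurable ?R (restrict_space borel (min_first_cube m))"
    by (intro measurable_restrict_space3 measurable_lborel_on_borel) auto
  from measurable_compose[OF this borel_measurable_continuous_on_restrict[OF assms(2)]]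
  have "G \<in> borel_measurable ?R" .
  then show ?thesis
    using sets_min_first_cube[OF assms(1)]
    by (simp add: borel_measurable_restrict_space_iff)
qed

lemma grid_index_range:
  assumes "x \<in> half_open_cube m" "0 < n"
  shows "length (grid_index m n x) = m" "set (grid_index m n x) \<subseteq> {1..n}"
proof -
  have "0 < x j" "x j \<le> 1" if "j < m" for j
    using assms(1) that by (auto simp: half_open_cube_def PiE_iff)
  then have "0 < real n * x j" "real n * x j \<le> real n" if "j < m" for j
    using assms(2) that by (auto intro!: mult_left_le)
  then have "1 \<le> nat \<lceil>real n * x j\<rceil> \<and> nat \<lceil>real n * x j\<rceil> \<le> n" if "j < m" for j
    using that by (auto simp: Suc_le_eq ceiling_le_iff nat_le_iff)
  then show "set (grid_index m n x) \<subseteq> {1..n}"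
    by (auto simp: grid_index_def)
qed (simp_all add: grid_index_def)

lemma in_grid_cell_iff:
  assumes "0 < n" "length c = m" "set c \<subseteq> {1..n}"
  shows "x \<in> grid_cell n c \<longleftrightarrow> x \<in> half_open_cube m \<and> c = grid_index m n x"
proof -
  have c: "1 \<le> c ! j" "c ! j \<le> n" if "j < m" for j
    using subsetD[OF assms(3) nth_mem[of j c]] assms(2) that by auto
  have eq: "(real (c ! j) - 1) / real n < y \<and> y \<le> real (c ! j) / real n \<longleftrightarrow>
      0 < y \<and> y \<le> 1 \<and> c ! j = nat \<lceil>real n * y\<rceil>" if "j < m" for j y
  proof
    assume "(real (c ! j) - 1) / real n < y \<and> y \<le> real (c ! j) / real n"
    then have *: "real (c ! j) - 1 < real n * y" "real n * y \<le> real (c ! j)"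
      using assms(1) by (auto simp: pos_divide_less_eq pos_le_divide_eq mult.commute)
    then have "\<lceil>real n * y\<rceil> = int (c ! j)"
      by (intro ceiling_unique) auto
    moreover have "1 \<le> real (c ! j)" "real (c ! j) \<le> real n"
      using c[OF that] by simp_all
    with * have "0 < real n * y" "real n * y \<le> real n * 1"
      by linarith+
    then have "0 < y" "y \<le> 1"
      using assms(1) by (simp_all add: zero_less_mult_iff)
    ultimately show "0 < y \<and> y \<le> 1 \<and> c ! j = nat \<lceil>real n * y\<rceil>"
      by simp
  next
    assume *: "0 < y \<and> y \<le> 1 \<and> c ! j = nat \<lceil>real n * y\<rceil>"
    then have "0 < real n * y"
      using assms(1) by (intro mult_pos_pos) auto
    then have "0 \<le> \<lceil>real n * y\<rceil>"
      by linarith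
    then have "real (nat \<lceil>real n * y\<rceil>) = of_int \<lceil>real n * y\<rceil>"
      by (rule of_nat_nat)
    moreover have "c ! j = nat \<lceil>real n * y\<rceil>"
      using * by blast
    ultimately have "real (c ! j) = of_int \<lceil>real n * y\<rceil>"
      by metis
    then have "real (c ! j) - 1 < real n * y" "real n * y \<le> real (c ! j)"
      by linarith+
    then show "(real (c ! j) - 1) / real n < y \<and> y \<le> real (c ! j) / real n"
      using assms(1) by (simp add: pos_divide_less_eq pos_le_divide_eq mult.commute)
  qed
  have "c = grid_index m n x \<longleftrightarrow> (\<forall>j<m. c ! j = nat \<lceil>real n * x j\<rceil>)"
    using assms(2) by (auto simp: grid_index_def list_eq_iff_nth_eq)
  then show ?thesis
    using eq assms(2) by (auto simp: grid_cell_def half_open_cube_def PiE_iff)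
qed

lemma emeasure_grid_cell:
  assumes "0 < n"
  shows "emeasure (lborel_on (length c)) (grid_cell n c) = ennreal (1 / real n ^ length c)"
proof -
  have "emeasure (lborel_on (length c)) (grid_cell n c) =
      ennreal (\<Prod>j<length c. real (c ! j) / real n - (real (c ! j) - 1) / real n)"
    unfolding grid_cell_def by (rule emeasure_box) (simp add: divide_right_mono)
  also have "(\<Prod>j<length c. real (c ! j) / real n - (real (c ! j) - 1) / real n) = 1 / real n ^ length c"
    by (simp add: diff_divide_distrib power_one_over)
  finally show ?thesis .
qed

text \<open>The integrand is constant on each grid cell, hence a step function whatever
  \<open>H\<close> is, and the cells have equal volume.\<close>

lemma integral_grid:
  fixes H :: "(nat \<Rightarrow> real) \<Rightarrow> real"
  assumes "0 < n"
  shows "(\<lambda>x. indicator (half_open_cube m) x * H (scaled_tuple n (grid_index m n x)))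
      \<in> borel_measurable (lborel_on m)" (is "?h \<in> _")
    and "(LINT x|lborel_on m. indicator (half_open_cube m) x * H (scaled_tuple n (grid_index m n x))) =
      (\<Sum>c | set c \<subseteq> {1..n} \<and> length c = m. H (scaled_tuple n c)) / real n ^ m"
proof -
  let ?L = "{c. set c \<subseteq> {1..n} \<and> length c = m}"
  have finL: "finite ?L"
    by (rule finite_lists_length_eq) simp
  have cell: "grid_cell n c \<in> sets (lborel_on m)" if "c \<in> ?L" for c
    using that unfolding grid_cell_def by auto
  have "?h x = (\<Sum>c\<in>?L. indicator (grid_cell n c) x * H (scaled_tuple n c))" for x
  proof (cases "x \<in> half_open_cube m")
    case True
    have "(\<Sum>c\<in>?L. indicator (grid_cell n c) x * H (scaled_tuple n c)) =
        (\<Sum>c\<in>?L. if c = grid_index m n x then H (scaled_tuple n c) else 0)"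
      using in_grid_cell_iff[OF assms, of _ m x] True by (intro sum.cong) auto
    also have "\<dots> = ?h x"
      using grid_index_range[OF True assms] True finL by simp
    finally show ?thesis ..
  next
    case False
    then show ?thesis
      using in_grid_cell_iff[OF assms, of _ m x] by auto
  qed
  then have h: "?h = (\<lambda>x. \<Sum>c\<in>?L. indicator (grid_cell n c) x * H (scaled_tuple n c))"
    by (rule ext)
  show "?h \<in> borel_measurable (lborel_on m)"
    unfolding h using cell by (intro borel_measurable_sum borel_measurable_times borel_measurable_indicator) auto
  have int: "integrable (lborel_on m) (\<lambda>x. indicator (grid_cell n c) x * H (scaled_tuple n c))" if "c \<in> ?L" for c
    using that cell[OF that] emeasure_grid_cell[OF assms, of c]
    by (intro integrable_mult_left integrable_real_indicator) auto
  have "integral\<^sup>L (lborel_on m) ?h =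
      (\<Sum>c\<in>?L. LINT x|lborel_on m. indicator (grid_cell n c) x * H (scaled_tuple n c))"
    unfolding h using int by (rule Bochner_Integration.integral_sum)
  also have "\<dots> = (\<Sum>c\<in>?L. H (scaled_tuple n c) / real n ^ m)"
  proof (rule sum.cong[OF refl])
    fix c
    assume c: "c \<in> ?L"
    have "measure (lborel_on m) (grid_cell n c) = 1 / real n ^ m"
      using c emeasure_grid_cell[OF assms, of c] by (simp add: measure_def)
    moreover have "grid_cell n c \<inter> space (lborel_on m) = grid_cell n c"
      using sets.sets_into_space[OF cell[OF c]] by auto
    ultimately show "(LINT x|lborel_on m. indicator (grid_cell n c) x * H (scaled_tuple n c)) =
      H (scaled_tuple n c) / real n ^ m"
      by simp
  qed
  finally show "integral\<^sup>L (lborel_on m) ?h =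
      (\<Sum>c | set c \<subseteq> {1..n} \<and> length c = m. H (scaled_tuple n c)) / real n ^ m"
    by (simp add: sum_divide_distrib)
qed

lemma tendsto_scaled_grid_index_component:
  assumes "x \<in> half_open_cube m"
  shows "(\<lambda>n. scaled_tuple n (grid_index m n x) j) \<longlonglongrightarrow> x j"
proof (cases "j < m")
  case True
  then have x: "0 < x j"
    using assms by (auto simp: half_open_cube_def PiE_iff)
  have bounds: "x j \<le> scaled_tuple n (grid_index m n x) j \<and>
      scaled_tuple n (grid_index m n x) j \<le> x j + 1 / real n" if "0 < n" for n
  proof -
    have eq: "scaled_tuple n (grid_index m n x) j = of_int \<lceil>real n * x j\<rceil> / real n"
      using True x that by (simp add: scaled_tuple_def grid_index_def)
    have "x j + 1 / real n = (real n * x j + 1) / real n"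
      using that by (simp add: field_simps)
    moreover have "of_int \<lceil>real n * x j\<rceil> \<le> real n * x j + 1"
      by linarith
    ultimately show ?thesis
      unfolding eq using that by (simp add: pos_le_divide_eq mult.commute divide_right_mono)
  qed
  have "\<forall>\<^sub>F n in sequentially. x j \<le> scaled_tuple n (grid_index m n x) j"
    by (rule eventually_mono[OF eventually_gt_at_top[of 0]]) (simp add: bounds)
  moreover have "\<forall>\<^sub>F n in sequentially. scaled_tuple n (grid_index m n x) j \<le> x j + 1 / real n"
    by (rule eventually_mono[OF eventually_gt_at_top[of 0]]) (simp add: bounds)
  moreover have "(\<lambda>n. x j + 1 / real n) \<longlonglongrightarrow> x j"
    using tendsto_add[OF tendsto_const lim_const_over_n, of "x j" 1] by simp
  ultimately show ?thesis
    by (rule tendsto_sandwich[OF _ _ tendsto_const])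
next
  case False
  \<comment> \<open>Outside the tuple both the point and its approximations have the default value
    \<open>undefined\<close>.\<close>
  then have "x j = undefined"
    using assms by (auto simp: half_open_cube_def PiE_iff extensional_def)
  moreover have "scaled_tuple n (grid_index m n x) j = undefined" for n
    using False by (simp add: scaled_tuple_def grid_index_def)
  ultimately show ?thesis
    by simp
qed

lemmas tendsto_scaled_grid_index = tendsto_fun_if_components[OF tendsto_scaled_grid_index_component]

lemma scaled_tuple_in_min_first_cube_iff:
  assumes "0 < n" "set c \<subseteq> {1..n}" "c \<noteq> []"
  shows "scaled_tuple n c \<in> min_first_cube (length c) \<longleftrightarrow> c ! 0 = Min (set c)"
proof -
  have "c ! 0 = Min (set c) \<longleftrightarrow> (\<forall>j<length c. c ! 0 \<le> c ! j)"
    using assms(3) by (subst eq_commute, subst Min_eq_iff) (simp_all add: all_set_conv_all_nth)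
  moreover have "scaled_tuple n c \<in> {..<length c} \<rightarrow>\<^sub>E {0..1}"
    using assms(1,2) nth_mem[of _ c] by (auto simp: scaled_tuple_def field_simps subset_iff)
  moreover have "1 \<le> length c"
    using assms(3) by (simp add: Suc_le_eq)
  ultimately show ?thesis
    using assms by (auto simp: min_first_cube_iff scaled_tuple_def divide_le_cancel)
qed

text \<open>Rounding up is monotone, so it preserves the weak inequalities that define the set.\<close>

lemma tendsto_at_grid_index:
  fixes G :: "(nat \<Rightarrow> real) \<Rightarrow> real"
  assumes "1 \<le> m" "continuous_on (min_first_cube m) G" and x: "x \<in> half_open_cube m"
  defines "H \<equiv> \<lambda>x. indicator (min_first_cube m) x * G x"
  shows "(\<lambda>n. H (scaled_tuple n (grid_index m n x))) \<longlonglongrightarrow> H x"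
proof -
  let ?y = "\<lambda>n. scaled_tuple n (grid_index m n x)"
  have lim: "?y \<longlonglongrightarrow> x"
    using x by (rule tendsto_scaled_grid_index)
  have y_in: "?y n \<in> {..<m} \<rightarrow>\<^sub>E {0..1}" if "0 < n" for n
    using grid_index_range[OF x that] that nth_mem[of _ "grid_index m n x"]
    by (auto simp: scaled_tuple_def field_simps subset_iff)
  show ?thesis
  proof (cases "x \<in> min_first_cube m")
    case True
    have ev: "\<forall>\<^sub>F n in sequentially. ?y n \<in> min_first_cube m"
      using eventually_gt_at_top[of 0]
    proof eventually_elim
      case (elim n)
      have "?y n 0 \<le> ?y n j" if "j < m" for j
      proof -
        have "x 0 \<le> x j"
          using True that assms(1) by (simp add: min_first_cube_iff)
        then have "nat \<lceil>real n * x 0\<rceil> \<le> nat \<lceil>real n * x j\<rceil>"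
          by (intro nat_mono ceiling_mono mult_left_mono) auto
        then show ?thesis
          using that by (simp add: scaled_tuple_def grid_index_def divide_right_mono)
      qed
      then show ?case
        using y_in[OF elim] assms(1) by (simp add: min_first_cube_iff)
    qed
    then have "(\<lambda>n. G (?y n)) \<longlonglongrightarrow> G x"
      using lim True by (intro continuous_on_tendsto_compose[OF assms(2)])
    moreover have "\<forall>\<^sub>F n in sequentially. G (?y n) = H (?y n)"
      using ev by eventually_elim (simp add: H_def)
    ultimately show ?thesis
      using True by (auto simp: H_def intro: Lim_transform_eventually)
  next
    case False
    have "x \<in> {..<m} \<rightarrow>\<^sub>E {0..1}"
      using x by (auto simp: half_open_cube_def PiE_iff less_imp_le)
    then obtain j where j: "j < m" "x j < x 0"
      using False assms(1) by (auto simp: min_first_cube_iff not_le)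
    have comp: "(\<lambda>n. ?y n i) \<longlonglongrightarrow> x i" for i
      using x by (rule tendsto_scaled_grid_index_component)
    \<comment> \<open>A strict inequality persists near the limit. So convergence holds at every
      point of the half-open cube, although the indicator jumps at the boundary of the set.\<close>
    have "\<forall>\<^sub>F n in sequentially. 0 < ?y n 0 - ?y n j"
      using j(2) by (intro order_tendstoD(1)[OF tendsto_diff[OF comp comp]]) simp
    then have "\<forall>\<^sub>F n in sequentially. 0 = H (?y n)"
    proof eventually_elim
      case (elim n)
      then have "?y n \<notin> min_first_cube m"
        using j(1) assms(1) by (auto simp: min_first_cube_iff not_le)
      then show ?case
        by (simp add: H_def)
    qed
    then show ?thesis
      using False by (auto simp: H_def intro: Lim_transform_eventually[OF tendsto_const])
  qed
qed

lemma half_open_cube: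
  shows "half_open_cube m \<in> sets (lborel_on m)" "emeasure (lborel_on m) (half_open_cube m) = 1"
  unfolding half_open_cube_def by (rule sets_box) (subst emeasure_box(1), simp_all)

text \<open>Only faces with a zero coordinate are lost; they are null because the closed and the
  half-open cube both have measure 1.\<close>

lemma AE_half_open_cube:
  "AE x in lborel_on m. x \<in> {..<m} \<rightarrow>\<^sub>E {0..1} \<longrightarrow> x \<in> half_open_cube m"
proof -
  let ?Q = "half_open_cube m" and ?C = "\<Pi>\<^sub>E j\<in>{..<m}. {0..1 :: real}"
  have C: "?C \<in> sets (lborel_on m)" "emeasure (lborel_on m) ?C = 1"
    by (rule sets_box) (subst emeasure_box(2), simp_all)
  have "?Q \<subseteq> ?C"
    unfolding half_open_cube_def by (intro PiE_mono) auto
  then have "emeasure (lborel_on m) (?C - ?Q) = 1 - 1"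
    using emeasure_Diff[OF _ C(1) half_open_cube(1)] C(2) half_open_cube(2) by simp
  then have "?C - ?Q \<in> null_sets (lborel_on m)"
    using C(1) half_open_cube(1) by (intro null_setsI sets.Diff) simp_all
  then have "AE x in lborel_on m. x \<notin> ?C - ?Q"
    by (rule AE_not_in)
  then show ?thesis
    by (rule eventually_mono) simp
qed

text \<open>The Riemann sums are integrals of step functions that converge pointwise on the
  half-open cube and are bounded by 1 there, so dominated convergence applies.\<close>

lemma tendsto_grid_sum:
  fixes G :: "(nat \<Rightarrow> real) \<Rightarrow> real"
  assumes m: "1 \<le> m" and G: "continuous_on (min_first_cube m) G"
    and G01: "\<And>x. x \<in> min_first_cube m \<Longrightarrow> 0 \<le> G x \<and> G x \<le> 1"
  shows "(\<lambda>n. (\<Sum>c | set c \<subseteq> {1..n} \<and> length c = m \<and> c ! 0 = Min (set c). G (scaled_tuple n c)) /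
    real n ^ m) \<longlonglongrightarrow> (LINT x:min_first_cube m|lborel_on m. G x)"
proof -
  let ?H = "\<lambda>x. indicator (min_first_cube m) x * G x"
  let ?Q = "half_open_cube m"
  let ?h = "\<lambda>n x. indicator ?Q x * ?H (scaled_tuple n (grid_index m n x))"
  have H01: "\<bar>?H x\<bar> \<le> 1" for x
    using G01[of x] by (auto simp: indicator_def)
  note sets_Q = half_open_cube(1)[of m] and emeasure_Q = half_open_cube(2)[of m]
  \<comment> \<open>The shift to \<open>Suc n\<close> avoids the degenerate grid with
    \<open>n = 0\<close>.\<close>
  have "(\<lambda>n. LINT x|lborel_on m. ?h (Suc n) x) \<longlonglongrightarrow> (LINT x|lborel_on m. indicator ?Q x * ?H x)"
  proof (rule integral_dominated_convergence[where w = "indicator ?Q"])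
    show "(\<lambda>x. indicator ?Q x * ?H x) \<in> borel_measurable (lborel_on m)"
      by (intro borel_measurable_times borel_measurable_indicator sets_Q
          borel_measurable_on_min_first_cube[OF m G])
    show "?h (Suc n) \<in> borel_measurable (lborel_on m)" for n
      by (rule integral_grid) simp
    show "integrable (lborel_on m) (indicator ?Q :: _ \<Rightarrow> real)"
      using sets_Q emeasure_Q by (intro integrable_real_indicator) auto
    show "AE x in lborel_on m. (\<lambda>n. ?h (Suc n) x) \<longlonglongrightarrow> indicator ?Q x * ?H x"
      using LIMSEQ_Suc[OF tendsto_at_grid_index[OF m G]] by (auto simp: indicator_def[of ?Q])
    show "AE x in lborel_on m. norm (?h (Suc n) x) \<le> indicator ?Q x" for n
      using H01 by (auto simp: indicator_def[of ?Q])
  qed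
  then have lim: "(\<lambda>n. LINT x|lborel_on m. ?h n x) \<longlonglongrightarrow> (LINT x|lborel_on m. indicator ?Q x * ?H x)"
    by (rule LIMSEQ_imp_Suc[where f = "\<lambda>n. integral\<^sup>L (lborel_on m) (?h n)"])
  have "AE x in lborel_on m. indicator ?Q x * ?H x = ?H x"
    by (rule eventually_mono[OF AE_half_open_cube[of m]]) (auto simp: indicator_def min_first_cube_def)
  then have "(LINT x|lborel_on m. indicator ?Q x * ?H x) = (LINT x|lborel_on m. ?H x)"
    by (intro integral_cong_AE borel_measurable_times borel_measurable_indicator sets_Q
        borel_measurable_on_min_first_cube[OF m G])
  with lim have "(\<lambda>n. LINT x|lborel_on m. ?h n x) \<longlonglongrightarrow> (LINT x:min_first_cube m|lborel_on m. G x)"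
    unfolding set_lebesgue_integral_def real_scaleR_def by (rule subst[rotated])
  moreover have "\<forall>\<^sub>F n in sequentially. (LINT x|lborel_on m. ?h n x) =
      (\<Sum>c | set c \<subseteq> {1..n} \<and> length c = m \<and> c ! 0 = Min (set c). G (scaled_tuple n c)) / real n ^ m"
    using eventually_gt_at_top[of 0]
  proof eventually_elim
    case (elim n)
    have "finite {c. set c \<subseteq> {1..n} \<and> length c = m}"
      by (rule finite_lists_length_eq) simp
    moreover have "scaled_tuple n c \<in> min_first_cube m \<longleftrightarrow> c ! 0 = Min (set c)"
      if "set c \<subseteq> {1..n}" "length c = m" for c
    proof -
      have "c \<noteq> []"
        using m that by auto
      then show ?thesis
        using that scaled_tuple_in_min_first_cube_iff[OF elim that(1)] by simp
    qed
    ultimately have "(\<Sum>c | set c \<subseteq> {1..n} \<and> length c = m. ?H (scaled_tuple n c)) =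
        (\<Sum>c | set c \<subseteq> {1..n} \<and> length c = m \<and> c ! 0 = Min (set c). G (scaled_tuple n c))"
      by (intro sum.mono_neutral_cong_right) (auto simp: indicator_def)
    then show ?case
      by (subst integral_grid(2)[OF elim]) simp
  qed
  ultimately show ?thesis
    by (rule Lim_transform_eventually)
qed

section \<open>Riemann sums over tuples with distinct entries\<close>

lemma tendsto_distinct_fraction:
  "(\<lambda>n. real (card {c. length c = m \<and> distinct c \<and> set c \<subseteq> {1..n}}) / real n ^ m) \<longlonglongrightarrow> 1"
proof -
  have "(\<lambda>n. \<Prod>i<m. 1 - real i / real n) \<longlonglongrightarrow> (\<Prod>i<m. 1 - 0)"
    by (intro tendsto_intros lim_const_over_n)
  moreover have "\<forall>\<^sub>F n in sequentially. (\<Prod>i<m. 1 - real i / real n) =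
      real (card {c. length c = m \<and> distinct c \<and> set c \<subseteq> {1..n}}) / real n ^ m"
    using eventually_gt_at_top[of m]
  proof eventually_elim
    case (elim n)
    have "card {c. length c = m \<and> distinct c \<and> set c \<subseteq> {1..n}} = \<Prod>{n - m + 1..n}"
      using elim card_lists_distinct_length_eq[of "{1..n}" m] by simp
    also have "\<dots> = (\<Prod>i<m. n - i)"
      using elim by (intro prod.reindex_bij_witness[where i = "\<lambda>i. n - i" and j = "\<lambda>i. n - i"]) auto
    finally have "real (card {c. length c = m \<and> distinct c \<and> set c \<subseteq> {1..n}}) = (\<Prod>i<m. real n - real i)"
      using elim by (simp add: of_nat_diff)
    also have "\<dots> / real n ^ m = (\<Prod>i<m. (real n - real i) / real n)"
      by (simp add: prod_dividef)
    also have "\<dots> = (\<Prod>i<m. 1 - real i / real n)"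
      using elim by (intro prod.cong) (auto simp: field_simps)
    finally show ?case ..
  qed
  ultimately show ?thesis
    by (auto intro: Lim_transform_eventually)
qed

text \<open>The omitted terms lie between 0 and 1 and belong to tuples with a repetition, which are
  a vanishing fraction of all \<open>n ^ m\<close> tuples.\<close>

proposition tendsto_distinct_grid_sum:
  fixes G :: "(nat \<Rightarrow> real) \<Rightarrow> real"
  assumes m: "1 \<le> m" and G: "continuous_on (min_first_cube m) G"
    and G01: "\<And>x. x \<in> min_first_cube m \<Longrightarrow> 0 \<le> G x \<and> G x \<le> 1"
  shows "(\<lambda>n. (\<Sum>c | length c = m \<and> distinct c \<and> set c \<subseteq> {1..n} \<and> c ! 0 = Min (set c).
      G (scaled_tuple n c)) / real n ^ m) \<longlonglongrightarrow> (LINT x:min_first_cube m|lborel_on m. G x)"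
proof -
  let ?A = "\<lambda>n. {c. set c \<subseteq> {1..n} \<and> length c = m \<and> c ! 0 = Min (set c)}"
  let ?D = "\<lambda>n. {c. length c = m \<and> distinct c \<and> set c \<subseteq> {1..n} \<and> c ! 0 = Min (set c)}"
  let ?L = "\<lambda>n. {c :: nat list. set c \<subseteq> {1..n} \<and> length c = m}"
  let ?d = "\<lambda>n. {c. length c = m \<and> distinct c \<and> set c \<subseteq> {1..n}}"
  let ?S = "\<lambda>n C. (\<Sum>c\<in>C. G (scaled_tuple n c)) / real n ^ m"
  have lim: "(\<lambda>n. 1 - real (card (?d n)) / real n ^ m) \<longlonglongrightarrow> 0"
    using tendsto_diff[OF tendsto_const tendsto_distinct_fraction, of 1 m] by simp
  have "\<forall>\<^sub>F n in sequentially. norm (?S n (?A n) - ?S n (?D n)) \<le> 1 - real (card (?d n)) / real n ^ m"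
    using eventually_gt_at_top[of 0]
  proof eventually_elim
    case (elim n)
    have finL: "finite (?L n)"
      by (rule finite_lists_length_eq) simp
    have fin: "finite (?A n)" "finite (?D n)" "finite (?d n)"
      by (rule finite_subset[OF _ finL]; auto)+
    have le1: "0 \<le> G (scaled_tuple n c)" "G (scaled_tuple n c) \<le> 1" if "c \<in> ?A n" for c
    proof -
      have "c \<noteq> []"
        using that m by auto
      then have "scaled_tuple n c \<in> min_first_cube m"
        using that scaled_tuple_in_min_first_cube_iff[OF elim, of c] by auto
      then show "0 \<le> G (scaled_tuple n c)" "G (scaled_tuple n c) \<le> 1"
        using G01 by auto
    qed
    have "(\<Sum>c\<in>?A n. G (scaled_tuple n c)) - (\<Sum>c\<in>?D n. G (scaled_tuple n c)) =
        (\<Sum>c\<in>?A n - ?D n. G (scaled_tuple n c))"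
      using fin by (subst sum_diff) auto
    then have diff: "?S n (?A n) - ?S n (?D n) = (\<Sum>c\<in>?A n - ?D n. G (scaled_tuple n c)) / real n ^ m"
      by (simp add: diff_divide_distrib[symmetric])
    have "(\<Sum>c\<in>?A n - ?D n. G (scaled_tuple n c)) \<le> (\<Sum>c\<in>?A n - ?D n. 1)"
      using le1 by (intro sum_mono) auto
    also have "\<dots> \<le> (\<Sum>c\<in>?L n - ?d n. 1)"
      using finL by (intro sum_mono2) auto
    also have "\<dots> = real (card (?L n) - card (?d n))"
      using fin by (simp add: card_Diff_subset subset_iff)
    also have "\<dots> = real n ^ m - real (card (?d n))"
      using card_mono[OF finL, of "?d n"]
      by (subst of_nat_diff) (auto simp: card_lists_length_eq)
    finally have "(\<Sum>c\<in>?A n - ?D n. G (scaled_tuple n c)) / real n ^ m \<le>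
        (real n ^ m - real (card (?d n))) / real n ^ m"
      by (rule divide_right_mono) simp
    moreover have "0 \<le> (\<Sum>c\<in>?A n - ?D n. G (scaled_tuple n c)) / real n ^ m"
      using le1 by (intro divide_nonneg_nonneg sum_nonneg) auto
    ultimately show ?case
      unfolding diff real_norm_def using elim by (simp add: diff_divide_distrib)
  qed
  then have "(\<lambda>n. ?S n (?A n) - ?S n (?D n)) \<longlonglongrightarrow> 0"
    using lim by (rule Lim_null_comparison)
  from tendsto_diff[OF tendsto_grid_sum[OF assms] this] show ?thesis
    by simp
qed

section \<open>Convergence of the cycle sums\<close>

lemma scaled_cycle_list_in_min_first_cube:
  assumes "c \<in> cycle_lists {1..n}"
  shows "scaled_tuple n c \<in> min_first_cube (length c)"
proof -
  have c: "c \<noteq> []" "set c \<subseteq> {1..n}" "c ! 0 = Min (set c)"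
    using assms by (auto simp: cycle_lists_def)
  then have "0 < n"
    by (cases c) auto
  with c show ?thesis
    by (simp add: scaled_tuple_in_min_first_cube_iff)
qed

lemma length_short_cycle_list:
  "c \<in> short_cycle_lists k n \<Longrightarrow> length c \<in> {1..k}"
  by (auto simp: short_cycle_lists_def cycle_lists_def Suc_le_eq)

lemma cycle_sum_eq:
  "cycle_sum f k n p = (\<Sum>c\<in>short_cycles k n p. f (length c) (scaled_tuple n c))"
proof -
  have "cycle_sum f k n p =
      (\<Sum>m=1..k. \<Sum>c | c \<in> short_cycles k n p \<and> length c = m. f (length c) (scaled_tuple n c))"
    unfolding cycle_sum_def
    by (intro sum.cong refl) (auto simp: cycles_of_length_eq short_cycles_def)
  also have "\<dots> = (\<Sum>c\<in>short_cycles k n p. f (length c) (scaled_tuple n c))"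
    using length_short_cycle_list short_cycles_subset[of k n p]
    by (intro sum.group finite_short_cycles) auto
  finally show ?thesis .
qed

lemma tendsto_sum_short_cycle_lists:
  assumes G: "\<And>m. m \<in> {1..k} \<Longrightarrow> continuous_on (min_first_cube m) (G m)"
    and G01: "\<And>m x. m \<in> {1..k} \<Longrightarrow> x \<in> min_first_cube m \<Longrightarrow> 0 \<le> G m x \<and> G m x \<le> 1"
  shows "(\<lambda>n. \<Sum>c\<in>short_cycle_lists k n. \<theta> (length c) * G (length c) (scaled_tuple n c) / real n ^ length c)
    \<longlonglongrightarrow> (\<Sum>m=1..k. \<theta> m * (LINT x:min_first_cube m|lborel_on m. G m x))"
proof -
  let ?D = "\<lambda>m n. {c. length c = m \<and> distinct c \<and> set c \<subseteq> {1..n} \<and> c ! 0 = Min (set c)}"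
  have "(\<lambda>n. \<Sum>m=1..k. \<theta> m * ((\<Sum>c\<in>?D m n. G m (scaled_tuple n c)) / real n ^ m))
      \<longlonglongrightarrow> (\<Sum>m=1..k. \<theta> m * (LINT x:min_first_cube m|lborel_on m. G m x))"
    using G G01 by (intro tendsto_sum tendsto_mult tendsto_const tendsto_distinct_grid_sum) auto
  moreover have "(\<Sum>c\<in>short_cycle_lists k n. \<theta> (length c) * G (length c) (scaled_tuple n c) / real n ^ length c) =
      (\<Sum>m=1..k. \<theta> m * ((\<Sum>c\<in>?D m n. G m (scaled_tuple n c)) / real n ^ m))" for n
  proof -
    have "(\<Sum>c\<in>short_cycle_lists k n. \<theta> (length c) * G (length c) (scaled_tuple n c) / real n ^ length c) =
        (\<Sum>m=1..k. \<Sum>c | c \<in> short_cycle_lists k n \<and> length c = m.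
          \<theta> (length c) * G (length c) (scaled_tuple n c) / real n ^ length c)"
      using length_short_cycle_list by (intro sum.group[symmetric] finite_short_cycle_lists) auto
    also have "\<dots> = (\<Sum>m=1..k. \<theta> m * ((\<Sum>c\<in>?D m n. G m (scaled_tuple n c)) / real n ^ m))"
      unfolding sum_divide_distrib sum_distrib_left
      by (intro sum.cong refl) (auto simp: short_cycle_lists_def cycle_lists_def)
    finally show ?thesis .
  qed
  ultimately show ?thesis
    by simp
qed

lemma prob_space_weighted_perm:
  assumes \<theta>: "\<forall>j\<ge>1. 0 \<le> \<theta> j" and "0 < perm_norm \<theta> n"
  shows "prob_space (weighted_perm \<theta> n)"
    and "integral\<^sup>L (weighted_perm \<theta> n) h =
      (\<Sum>p | p permutes {1..n}. weight_on \<theta> {1..n} p * h p) / total_weight \<theta> {1..n}"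
proof -
  let ?P = "{p. p permutes {1..n}}"
  let ?w = "\<lambda>p. weight_on \<theta> {1..n} p / total_weight \<theta> {1..n}"
  have W: "0 < total_weight \<theta> {1..n}"
    unfolding perm_norm_eq_total_weight[symmetric] using assms(2) by simp
  have eq: "weighted_perm \<theta> n = point_measure ?P (\<lambda>p. ennreal (?w p))"
    by (simp only: weighted_perm_def cycle_weight_eq_weight_on perm_norm_eq_total_weight)
  have fin: "finite ?P"
    by (rule finite_permutations) simp
  have nonneg: "0 \<le> ?w p" for p
    using W weight_on_nonneg[OF \<theta>] by (intro divide_nonneg_nonneg) auto
  have "(\<Sum>p\<in>?P. ?w p) = 1"
    using W by (simp only: sum_divide_distrib[symmetric] total_weight_def[symmetric]) simp
  then show "prob_space (weighted_perm \<theta> n)"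
    unfolding eq using fin nonneg by (intro prob_space_point_measure) auto
  show "integral\<^sup>L (weighted_perm \<theta> n) h =
      (\<Sum>p\<in>?P. weight_on \<theta> {1..n} p * h p) / total_weight \<theta> {1..n}"
    unfolding eq by (subst lebesgue_integral_point_measure_finite[OF fin nonneg])
      (simp add: sum_divide_distrib)
qed

lemma measurable_weighted_perm: "h \<in> measurable (weighted_perm \<theta> n) borel"
  by (simp add: weighted_perm_def)

text \<open>This makes the limiting transform tend to 1 along \<open>1 / real (Suc j)\<close>, the
  condition behind tightness. The integrands are dominated by the indicator of a set of finite
  measure.\<close>

lemma tendsto_integral_min_first_cube_0:
  fixes F :: "(nat \<Rightarrow> real) \<Rightarrow> real"
  assumes m: "1 \<le> m" and F: "continuous_on (min_first_cube m) F"
    and F0: "\<And>x. x \<in> min_first_cube m \<Longrightarrow> 0 \<le> F x"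
  shows "(\<lambda>j. LINT x:min_first_cube m|lborel_on m. 1 - exp (- (1 / real (Suc j)) * F x)) \<longlonglongrightarrow> 0"
proof -
  let ?X = "min_first_cube m"
  have "(\<lambda>j. LINT x|lborel_on m. indicator ?X x * (1 - exp (- (1 / real (Suc j)) * F x)))
      \<longlonglongrightarrow> (LINT x|lborel_on m. 0)"
  proof (rule integral_dominated_convergence[where w = "indicator ?X"])
    show "(\<lambda>x. indicator ?X x * (1 - exp (- (1 / real (Suc j)) * F x))) \<in> borel_measurable (lborel_on m)" for j
      by (intro borel_measurable_on_min_first_cube[OF m] continuous_intros F)
    have "?X \<subseteq> (\<Pi>\<^sub>E j\<in>{..<m}. {0..1 :: real})"
      by (auto simp: min_first_cube_def)
    then have "emeasure (lborel_on m) ?X \<le> emeasure (lborel_on m) (\<Pi>\<^sub>E j\<in>{..<m}. {0..1 :: real})"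
      by (rule emeasure_mono) (rule sets_box)
    also have "\<dots> = 1"
      by (subst emeasure_box(2)) simp_all
    finally have "emeasure (lborel_on m) ?X < \<infinity>"
      by (rule order.strict_trans1) simp
    then show "integrable (lborel_on m) (indicator ?X :: _ \<Rightarrow> real)"
      by (intro integrable_real_indicator sets_min_first_cube[OF m])
    show "AE x in lborel_on m. norm (indicator ?X x * (1 - exp (- (1 / real (Suc j)) * F x))) \<le> indicator ?X x" for j
      using F0 by (auto simp: indicator_def)
    have "(\<lambda>j. 1 - exp (- (1 / real (Suc j)) * y)) \<longlonglongrightarrow> 1 - exp (- 0 * y)" for y
      by (intro tendsto_intros LIMSEQ_Suc[OF lim_const_over_n])
    then show "AE x in lborel_on m. (\<lambda>j. indicator ?X x * (1 - exp (- (1 / real (Suc j)) * F x))) \<longlonglongrightarrow> 0"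
      by (intro AE_I2 tendsto_mult_right_zero) simp
  qed simp
  then show ?thesis
    by (simp add: set_lebesgue_integral_def)
qed

theorem proposition3:
  fixes \<theta> :: "nat \<Rightarrow> real"
    and f :: "nat \<Rightarrow> (nat \<Rightarrow> real) \<Rightarrow> real"
    and k :: nat
  assumes "\<And>j. 1 \<le> j \<Longrightarrow> 0 \<le> \<theta> j"
    and "(\<lambda>n. perm_norm \<theta> (n - 1) / perm_norm \<theta> n) \<longlonglongrightarrow> 1"
    and "1 \<le> k"
    and "\<And>m. m \<in> {1..k} \<Longrightarrow> continuous_on (min_first_cube m) (f m)"
    and "\<And>m x. m \<in> {1..k} \<Longrightarrow> x \<in> min_first_cube m \<Longrightarrow> 0 \<le> f m x"
  shows "(\<exists>!\<mu>. has_laplace_transform \<mu> (limit_laplace \<theta> f k)) \<and>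
    (\<forall>\<mu>. has_laplace_transform \<mu> (limit_laplace \<theta> f k) \<longrightarrow>
      weak_conv_m (\<lambda>n. distr (weighted_perm \<theta> n) borel (cycle_sum f k n)) \<mu>)"
proof -
  let ?\<nu> = "\<lambda>n. distr (weighted_perm \<theta> n) borel (cycle_sum f k n)"
  let ?\<phi> = "limit_laplace \<theta> f k"
  let ?g = "\<lambda>t n c. 1 - exp (- t * f (length c) (scaled_tuple n c))"
  have \<theta>: "\<forall>j\<ge>1. 0 \<le> \<theta> j"
    using assms(1) by blast
  have f_cycle: "0 \<le> f (length c) (scaled_tuple n c)" if "c \<in> short_cycle_lists k n" for c n
    using assms(5)[OF length_short_cycle_list[OF that]] scaled_cycle_list_in_min_first_cube[of c n] that
    by (simp add: short_cycle_lists_def)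
  have exp_cycle_sum: "exp (- t * cycle_sum f k n p) = (\<Prod>c\<in>short_cycles k n p. 1 - ?g t n c)" for t n p
    by (simp add: cycle_sum_eq exp_sum finite_short_cycles sum_distrib_left sum_negf[symmetric])
  have lim: "(\<lambda>n. (\<Sum>p | p permutes {1..n}. weight_on \<theta> {1..n} p * exp (- t * cycle_sum f k n p)) /
      total_weight \<theta> {1..n}) \<longlonglongrightarrow> ?\<phi> t" if "0 \<le> t" for t
    unfolding exp_cycle_sum limit_laplace_def
  proof (rule tendsto_expected_product[OF \<theta> assms(2)])
    show "\<forall>n. \<forall>c\<in>short_cycle_lists k n. 0 \<le> ?g t n c \<and> ?g t n c \<le> 1"
      using f_cycle that by simp
    show "(\<lambda>n. \<Sum>c\<in>short_cycle_lists k n. \<theta> (length c) * ?g t n c / real n ^ length c)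
      \<longlonglongrightarrow> (\<Sum>m=1..k. \<theta> m * (LINT x:min_first_cube m|lborel_on m. 1 - exp (- t * f m x)))"
      using that assms(5)
      by (intro tendsto_sum_short_cycle_lists[where G = "\<lambda>m x. 1 - exp (- t * f m x)"]
          continuous_intros assms(4)) auto
  qed
  \<comment> \<open>For small \<open>n\<close> the normalization may vanish and
    \<open>weighted_perm\<close> be the zero measure, so the continuity theorem is applied to the
    sequence shifted by \<open>N\<close>.\<close>
  obtain N where N: "\<And>n. N \<le> n \<Longrightarrow> 0 < perm_norm \<theta> n"
    using eventually_perm_norm_pos[OF \<theta> assms(2)] by (auto simp: eventually_sequentially)
  have \<nu>: "real_distribution (?\<nu> (n + N))" for n
    by (rule prob_space.real_distribution_distr[OF prob_space_weighted_perm(1)[OF \<theta> N]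
          measurable_weighted_perm]) simp
  have nonneg: "AE x in ?\<nu> (n + N). 0 \<le> x" for n
  proof -
    have "0 \<le> cycle_sum f k n p" for n p
      unfolding cycle_sum_eq using f_cycle short_cycles_subset[of k n p] by (intro sum_nonneg) auto
    then show ?thesis
      by (subst AE_distr_iff[OF measurable_weighted_perm]) simp_all
  qed
  have laplace: "(\<lambda>n. LINT x|?\<nu> (n + N). exp (- t * x)) \<longlonglongrightarrow> ?\<phi> t" if "0 \<le> t" for t
  proof -
    have "(LINT x|?\<nu> (n + N). exp (- t * x)) =
        (\<Sum>p | p permutes {1..n + N}. weight_on \<theta> {1..n + N} p * exp (- t * cycle_sum f k (n + N) p)) /
          total_weight \<theta> {1..n + N}" for n
      by (subst integral_distr[OF measurable_weighted_perm])
        (simp_all only: prob_space_weighted_perm(2)[OF \<theta> N] le_add2, measurable)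
    then show ?thesis
      using LIMSEQ_ignore_initial_segment[OF lim[OF that], of N] by simp
  qed
  have "(\<lambda>j. ?\<phi> (1 / real (Suc j))) \<longlonglongrightarrow> exp (- (\<Sum>m=1..k. \<theta> m * 0))"
    unfolding limit_laplace_def
    by (intro tendsto_exp tendsto_minus tendsto_sum tendsto_mult tendsto_const
        tendsto_integral_min_first_cube_0 assms(4,5)) auto
  then have \<phi>: "(\<lambda>j. ?\<phi> (1 / real (Suc j))) \<longlonglongrightarrow> 1"
    by simp
  note continuity = laplace_continuity[of "\<lambda>n. ?\<nu> (n + N)", OF \<nu> nonneg laplace \<phi>]
  have "\<exists>!\<mu>. has_laplace_transform \<mu> ?\<phi>"
    using continuity(1) has_laplace_transform_unique by blast
  \<comment> \<open>Weak convergence means convergence of the distribution function at each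
    continuity point of the limit, so the shift can be undone pointwise.\<close>
  moreover have "weak_conv_m ?\<nu> \<mu>" if "has_laplace_transform \<mu> ?\<phi>" for \<mu>
    using continuity(2)[OF _ that] unfolding weak_conv_m_def weak_conv_def
    by (blast intro: LIMSEQ_offset)
  ultimately show ?thesis
    by blast
qed

end
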